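(* For every finitely generated purely loxodromic Fuchsian group $\Gamma$ with $\Lambda(\Gamma)=\mathbb{S}^1_\infty$, there exist non-elementary subgroups $\Phi$ and $\Theta$ of $\Gamma$ such that $\Phi\cap\Theta$ is trivial and $\Lambda(\Phi)\cap\Lambda(\Theta)$ contains exactly two points. In particular, $\Lambda(\Phi\cap\Theta)\ne\Lambda(\Phi)\cap\Lambda(\Theta)$ for these $\Phi$ and $\Theta$.
   Context: $\mathbb{H}^2$ is the hyperbolic plane with circle at infinity $\mathbb{S}^1_\infty$. A Fuchsian group is a discrete subgroup of the group $\mathrm{Isom}^+(\mathbb{H}^2)$ of orientation-preserving isometries of $\mathbb{H}^2$. It is purely loxodromic if it contains no parabolic or elliptic elements, i.e. every non-trivial element is loxodromic (hyperbolic). It is non-elementary if it is not virtually abelian. The limit set $\Lambda(G)\subseteq\mathbb{S}^1_\infty$ of a purely loxodromic Fuchsian group $G$ is the closure in $\mathbb{S}^1_\infty$ of the set of fixed points of loxodromic elements of $G$ (so it is empty if $G$ is trivial). *)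

theory Defs
  imports
    "HOL-Analysis.Analysis"
    "HOL-Algebra.Bij"
    "HOL-Algebra.Generated_Groups"
begin

section \<open>The hyperbolic plane in the Poincare disc model\<close>

abbreviation hyp_plane :: "complex set" where
  "hyp_plane \<equiv> ball 0 1"

abbreviation circle_at_infinity :: "complex set" where
  "circle_at_infinity \<equiv> sphere 0 1"

text \<open>The distance function of the Riemannian metric
  \<open>4 \<bar>dz\<bar>\<^sup>2 / (1 - \<bar>z\<bar>\<^sup>2)\<^sup>2\<close> (curvature \<open>-1\<close>) on the unit disc.\<close>

definition hyp_dist :: "complex \<Rightarrow> complex \<Rightarrow> real" where
  "hyp_dist z w =
     arcosh (1 + 2 * (cmod (z - w))\<^sup>2 / ((1 - (cmod z)\<^sup>2) * (1 - (cmod w)\<^sup>2)))"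

text \<open>Determinant of a real-linear map of the plane, in the basis \<open>1, \<i>\<close>.\<close>

definition jac_det :: "(complex \<Rightarrow> complex) \<Rightarrow> real" where
  "jac_det L = Re (L 1) * Im (L \<i>) - Im (L 1) * Re (L \<i>)"

text \<open>Isometries of the hyperbolic plane are automatically smooth, so demanding differentiability
  here is no restriction beyond the sign of the Jacobian determinant.\<close>

definition orientation_preserving :: "(complex \<Rightarrow> complex) \<Rightarrow> bool" where
  "orientation_preserving f \<longleftrightarrow>
     (\<forall>z\<in>hyp_plane. \<exists>L. (f has_derivative L) (at z) \<and> jac_det L > 0)"

definition Isom_plus :: "(complex \<Rightarrow> complex) monoid" where
  "Isom_plus = BijGroup hyp_plane
     \<lparr>carrier := {f \<in> Bij hyp_plane.
        (\<forall>z\<in>hyp_plane. \<forall>w\<in>hyp_plane. hyp_dist (f z) (f w) = hyp_dist z w) \<and>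
        orientation_preserving f}\<rparr>"

section \<open>Fuchsian groups\<close>

text \<open>Here \<^const>\<open>discrete\<close> refers to the product topology on \<^typ>\<open>complex \<Rightarrow> complex\<close>.
  Elements of \<^const>\<open>Isom_plus\<close> are extensional (constant outside the disc), so on
  \<open>carrier Isom_plus\<close> this is the topology of pointwise convergence on the hyperbolic plane,
  which on isometries coincides with the compact-open (Lie group) topology.\<close>

definition fuchsian :: "(complex \<Rightarrow> complex) set \<Rightarrow> bool" where
  "fuchsian G \<longleftrightarrow> subgroup G Isom_plus \<and> discrete G"

definition finitely_generated :: "(complex \<Rightarrow> complex) set \<Rightarrow> bool" where
  "finitely_generated G \<longleftrightarrow> (\<exists>S. finite S \<and> S \<subseteq> G \<and> generate Isom_plus S = G)"

text \<open>Isometries are only defined on the open disc; their continuous extension to the circle at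
  infinity fixes \<open>\<xi>\<close> iff \<open>f z\<close> tends to \<open>\<xi>\<close> as \<open>z\<close> tends to \<open>\<xi>\<close>
  within the disc.\<close>

definition ideal_fixed_points :: "(complex \<Rightarrow> complex) \<Rightarrow> complex set" where
  "ideal_fixed_points f = {\<xi> \<in> circle_at_infinity. (f \<longlongrightarrow> \<xi>) (at \<xi> within hyp_plane)}"

definition elliptic :: "(complex \<Rightarrow> complex) \<Rightarrow> bool" where
  "elliptic f \<longleftrightarrow>
     f \<in> carrier Isom_plus \<and> f \<noteq> \<one>\<^bsub>Isom_plus\<^esub> \<and> (\<exists>z\<in>hyp_plane. f z = z)"

definition parabolic :: "(complex \<Rightarrow> complex) \<Rightarrow> bool" where
  "parabolic f \<longleftrightarrow>
     f \<in> carrier Isom_plus \<and> (\<forall>z\<in>hyp_plane. f z \<noteq> z) \<and> card (ideal_fixed_points f) = 1"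

definition loxodromic :: "(complex \<Rightarrow> complex) \<Rightarrow> bool" where
  "loxodromic f \<longleftrightarrow>
     f \<in> carrier Isom_plus \<and> (\<forall>z\<in>hyp_plane. f z \<noteq> z) \<and> card (ideal_fixed_points f) = 2"

definition purely_loxodromic :: "(complex \<Rightarrow> complex) set \<Rightarrow> bool" where
  "purely_loxodromic G \<longleftrightarrow> (\<forall>g\<in>G. \<not> parabolic g \<and> \<not> elliptic g)"

definition limit_set :: "(complex \<Rightarrow> complex) set \<Rightarrow> complex set" where
  "limit_set G = closure (\<Union>g\<in>{g \<in> G. loxodromic g}. ideal_fixed_points g)"

definition virtually_abelian :: "('a, 'b) monoid_scheme \<Rightarrow> bool" where
  "virtually_abelian G \<longleftrightarrow>
     (\<exists>A. subgroup A G \<and> comm_group (G\<lparr>carrier := A\<rparr>) \<and> finite (rcosets\<^bsub>G\<^esub> A))"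

definition non_elementary :: "(complex \<Rightarrow> complex) set \<Rightarrow> bool" where
  "non_elementary G \<longleftrightarrow> \<not> virtually_abelian (Isom_plus\<lparr>carrier := G\<rparr>)"

section \<open>The orientation-preserving isometries form a group\<close>

lemma linear_complex_expand:
  assumes "linear L"
  shows "L z = of_real (Re z) * L 1 + of_real (Im z) * L \<i>"
proof -
  have "L z = L (Re z *\<^sub>R 1 + Im z *\<^sub>R \<i>)"
    by (rule arg_cong[of _ _ L]) (simp add: complex_eq_iff)
  also have "\<dots> = Re z *\<^sub>R L 1 + Im z *\<^sub>R L \<i>"
    using assms by (simp add: linear_add linear_scale)
  finally show ?thesis by (simp add: scaleR_conv_of_real)
qed

lemma jac_det_compose:
  assumes "linear L" "linear M"
  shows "jac_det (L \<circ> M) = jac_det L * jac_det M"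
  unfolding jac_det_def o_def
    linear_complex_expand[OF assms(1), of "M 1"] linear_complex_expand[OF assms(1), of "M \<i>"]
  by (simp add: algebra_simps)

lemma orientation_preserving_id: "orientation_preserving (\<lambda>z\<in>hyp_plane. z)"
  unfolding orientation_preserving_def
proof
  fix z :: complex assume z: "z \<in> hyp_plane"
  have "((\<lambda>z\<in>hyp_plane. z) has_derivative (\<lambda>z. z)) (at z)"
    by (rule has_derivative_transform_within_open[OF has_derivative_ident open_ball z]) auto
  then show "\<exists>L. ((\<lambda>z\<in>hyp_plane. z) has_derivative L) (at z) \<and> jac_det L > 0"
    by (auto simp: jac_det_def intro!: exI[of _ "\<lambda>z. z"])
qed

lemma orientation_preserving_compose:
  assumes f: "orientation_preserving f" and g: "orientation_preserving g"
    and gB: "g \<in> hyp_plane \<rightarrow> hyp_plane"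
  shows "orientation_preserving (compose hyp_plane f g)"
  unfolding orientation_preserving_def
proof
  fix z :: complex assume z: "z \<in> hyp_plane"
  obtain M where M: "(g has_derivative M) (at z)" "jac_det M > 0"
    using g z unfolding orientation_preserving_def by blast
  obtain L where L: "(f has_derivative L) (at (g z))" "jac_det L > 0"
    using f gB z unfolding orientation_preserving_def by blast
  have "(f \<circ> g has_derivative L \<circ> M) (at z)"
    by (rule diff_chain_at[OF M(1) L(1)])
  then have "(compose hyp_plane f g has_derivative L \<circ> M) (at z)"
    by (rule has_derivative_transform_within_open[OF _ open_ball z]) (simp add: compose_def)
  moreover have "jac_det (L \<circ> M) > 0"
    using L M by (simp add: jac_det_compose has_derivative_linear)
  ultimately show "\<exists>L. (compose hyp_plane f g has_derivative L) (at z) \<and> jac_det L > 0"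
    by blast
qed

lemma orientation_preserving_inverse:
  assumes f: "orientation_preserving f" and bij: "bij_betw f hyp_plane hyp_plane"
  shows "orientation_preserving (restrict (inv_into hyp_plane f) hyp_plane)"
  unfolding orientation_preserving_def
proof
  fix w :: complex assume w: "w \<in> hyp_plane"
  define z where "z = inv_into hyp_plane f w"
  have z: "z \<in> hyp_plane" "f z = w"
    using w bij_betwE[OF bij_betw_inv_into[OF bij]] bij_betw_inv_into_right[OF bij]
    unfolding z_def by blast+
  obtain L where L: "(f has_derivative L) (at z)" "jac_det L > 0"
    using f z unfolding orientation_preserving_def by blast
  have lin: "linear L" using L(1) by (rule has_derivative_linear)
  have "inj L"
  proof (rule linear_injective_0[OF lin, THEN iffD2], intro allI impI)
    fix v assume v: "L v = 0"
    have re: "Re v * Re (L 1) + Im v * Re (L \<i>) = 0"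
      and im: "Re v * Im (L 1) + Im v * Im (L \<i>) = 0"
      using v linear_complex_expand[OF lin, of v] by (auto simp: complex_eq_iff)
    have "Re v * jac_det L = (Re v * Re (L 1) + Im v * Re (L \<i>)) * Im (L \<i>)
        - (Re v * Im (L 1) + Im v * Im (L \<i>)) * Re (L \<i>)"
      by (simp add: jac_det_def algebra_simps)
    moreover have "Im v * jac_det L = (Re v * Im (L 1) + Im v * Im (L \<i>)) * Re (L 1)
        - (Re v * Re (L 1) + Im v * Re (L \<i>)) * Im (L 1)"
      by (simp add: jac_det_def algebra_simps)
    ultimately have "Re v = 0" "Im v = 0" using re im L(2) by auto
    then show "v = 0" by (simp add: complex_eq_iff)
  qed
  then obtain M where M: "linear M" "\<forall>x. M (L x) = x" "\<forall>x. L (M x) = x"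
    using linear_injective_isomorphism[OF lin] by blast
  have LM: "L \<circ> M = id" using M(3) by auto
  have cont: "continuous_on hyp_plane f"
    using f unfolding orientation_preserving_def
    by (meson continuous_at_imp_continuous_on has_derivative_continuous)
  have "(inv_into hyp_plane f has_derivative M) (at (f z))"
    using bij by (intro has_derivative_inverse_strong[OF open_ball z(1) cont _ L(1) LM])
      (auto simp: bij_betw_def)
  then have "(restrict (inv_into hyp_plane f) hyp_plane has_derivative M) (at w)"
    unfolding z(2) by (rule has_derivative_transform_within_open[OF _ open_ball w]) simp
  moreover have "jac_det L * jac_det M = 1"
    using jac_det_compose[OF lin M(1)] unfolding LM by (simp add: jac_det_def)
  then have "jac_det M > 0"
    using L(2) by (metis zero_less_mult_pos zero_less_one)
  ultimately show "\<exists>L. (restrict (inv_into hyp_plane f) hyp_plane has_derivative L) (at w)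
      \<and> jac_det L > 0"
    by blast
qed

lemma subgroup_Isom_plus: "subgroup (carrier Isom_plus) (BijGroup hyp_plane)"
proof (rule group.subgroupI[OF group_BijGroup])
  show "carrier Isom_plus \<subseteq> carrier (BijGroup hyp_plane)"
    by (auto simp: Isom_plus_def BijGroup_def)
  have "(\<lambda>z\<in>hyp_plane. z) \<in> carrier Isom_plus"
    using orientation_preserving_id id_Bij by (auto simp: Isom_plus_def)
  then show "carrier Isom_plus \<noteq> {}" by blast
next
  fix f assume f: "f \<in> carrier Isom_plus"
  then have B: "f \<in> Bij hyp_plane" by (simp add: Isom_plus_def)
  then have bij: "bij_betw f hyp_plane hyp_plane" by (simp add: Bij_def)
  let ?g = "restrict (inv_into hyp_plane f) hyp_plane"
  have "hyp_dist (?g z) (?g w) = hyp_dist z w" if "z \<in> hyp_plane" "w \<in> hyp_plane" for z w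
  proof -
    have "inv_into hyp_plane f u \<in> hyp_plane" "f (inv_into hyp_plane f u) = u"
      if "u \<in> hyp_plane" for u
      using that bij_betwE[OF bij_betw_inv_into[OF bij]] bij_betw_inv_into_right[OF bij] by blast+
    moreover have "hyp_dist (f a) (f b) = hyp_dist a b"
      if "a \<in> hyp_plane" "b \<in> hyp_plane" for a b
      using f that by (simp add: Isom_plus_def)
    ultimately show ?thesis using that by (metis restrict_apply')
  qed
  then have "?g \<in> carrier Isom_plus"
    using f restrict_inv_into_Bij[OF B] orientation_preserving_inverse[OF _ bij]
    by (simp add: Isom_plus_def)
  then show "inv\<^bsub>BijGroup hyp_plane\<^esub> f \<in> carrier Isom_plus"
    by (simp only: inv_BijGroup[OF B])
next
  fix f g assume f: "f \<in> carrier Isom_plus" and g: "g \<in> carrier Isom_plus"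
  then have B: "f \<in> Bij hyp_plane" "g \<in> Bij hyp_plane" by (simp_all add: Isom_plus_def)
  have gB: "g \<in> hyp_plane \<rightarrow> hyp_plane" using B(2) by (rule Bij_imp_funcset)
  have "hyp_dist (compose hyp_plane f g z) (compose hyp_plane f g w) = hyp_dist z w"
    if "z \<in> hyp_plane" "w \<in> hyp_plane" for z w
  proof -
    have "g z \<in> hyp_plane" "g w \<in> hyp_plane" using gB that by blast+
    then show ?thesis using f g that by (simp add: Isom_plus_def compose_def)
  qed
  then have "compose hyp_plane f g \<in> carrier Isom_plus"
    using f g gB compose_Bij[OF B] orientation_preserving_compose
    by (simp add: Isom_plus_def)
  then show "f \<otimes>\<^bsub>BijGroup hyp_plane\<^esub> g \<in> carrier Isom_plus"
    using B by (simp add: BijGroup_def)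
qed

theorem group_Isom_plus: "group Isom_plus"
proof -
  have "Isom_plus = BijGroup hyp_plane\<lparr>carrier := carrier Isom_plus\<rparr>"
    by (simp add: Isom_plus_def)
  then show ?thesis
    using subgroup.subgroup_is_group[OF subgroup_Isom_plus group_BijGroup] by simp
qed

end

theory Submission
  imports Defs "HOL-Algebra.Group_Action"
begin

text \<open>Take a loxodromic \<open>\<gamma> \<in> \<Gamma>\<close> with fixed points \<open>p\<close> and \<open>q\<close>.  They cut the circle into two open arcs.
  The groups \<open>\<Phi>\<close> and \<open>\<Theta>\<close> are infinitely generated, one for each arc, and every non-trivial element
  of \<open>\<Phi>\<close> maps the whole complement of the first arc into that arc, and likewise for \<open>\<Theta>\<close> and the second
  arc.  Three consequences follow at once.  A common non-trivial element would send \<open>p\<close> into both arcs,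
  so \<open>\<Phi> \<inter> \<Theta>\<close> is trivial.  The fixed points of the elements of \<open>\<Phi>\<close> lie in the first arc, so
  \<open>\<Lambda>(\<Phi>)\<close> lies in its closure, and \<open>\<Lambda>(\<Phi>) \<inter> \<Lambda>(\<Theta>)\<close> is contained in \<open>{p, q}\<close>.  The limit set of the
  trivial group is empty, so it remains to have \<open>p\<close> and \<open>q\<close> in both limit sets.

  To construct \<open>\<Phi>\<close> (\<open>one_sided_subgroup\<close>), find \<open>\<phi> \<in> \<Gamma>\<close> with both fixed points in the arc
  (\<open>axis_on_one_side\<close>).  Since \<open>\<Lambda>(\<Gamma>)\<close> is the whole circle, some loxodromic \<open>h \<in> \<Gamma>\<close> has a fixed point in
  the arc.  Its other fixed point is neither \<open>p\<close> nor \<open>q\<close>, because in a group without parabolic elements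
  two elements with a common fixed point have the same axis
  (\<open>common_fixed_point_imp_common_axis\<close>).  So \<open>h\<^sup>n\<close> moves both \<open>p\<close> and \<open>q\<close> into the arc for a suitable
  \<open>n\<close>, and \<open>\<phi> = h\<^sup>n \<gamma> h\<^sup>-\<^sup>n\<close> serves.  With high powers in place of \<open>\<gamma>\<close> and \<open>\<phi>\<close>, let \<open>\<Phi>\<close> be
  generated by all \<open>\<gamma>\<^sup>n \<phi> \<gamma>\<^sup>-\<^sup>n\<close>.  These generators play ping-pong on the disjoint sets \<open>\<gamma>\<^sup>n I\<close>,
  where \<open>I\<close> is a small neighbourhood of the fixed points of \<open>\<phi>\<close>; all these sets lie in the arc since
  \<open>\<gamma>\<close> preserves it.  Their fixed points are the images under \<open>\<gamma>\<^sup>n\<close> of those of \<open>\<phi>\<close>, which tend to \<open>p\<close>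
  and \<open>q\<close> as \<open>n\<close> tends to the two infinities.

  The dynamics are computed in the coordinate \<open>(z - p) / (z - q)\<close>, in which \<open>\<gamma>\<close> is multiplication by
  a positive number other than \<open>1\<close> (\<open>axis_coord\<close>).  This rests on the fact that orientation-preserving
  isometries are linear fractional transformations (\<open>Isom_plus_mob\<close>) and therefore extend to the
  circle.\<close>

section \<open>Powers in groups and ping-pong\<close>

context group
begin

text \<open>By the pigeonhole principle two of the cosets \<open>A x\<^sup>n\<close> coincide.\<close>

lemma power_in_finite_index_subgroup:
  assumes A: "subgroup A G" and fin: "finite (rcosets A)" and x: "x \<in> carrier G"
  obtains m :: nat where "m > 0" "x [^] m \<in> A"
proof -
  have "range (\<lambda>n::nat. A #> x [^] n) \<subseteq> rcosets A"
    using rcosetsI[OF subgroup.subset[OF A]] x by auto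
  then have "finite (range (\<lambda>n::nat. A #> x [^] n))"
    using fin by (rule finite_subset)
  then have "\<not> inj (\<lambda>n::nat. A #> x [^] n)"
    using finite_imageD by (metis infinite_UNIV_nat)
  then obtain i j :: nat where "A #> x [^] i = A #> x [^] j" "i \<noteq> j"
    unfolding inj_def by blast
  then obtain i j :: nat where ij: "A #> x [^] i = A #> x [^] j" "i < j"
    by (metis nat_neq_iff)
  have "x [^] j \<in> A #> x [^] i"
    using rcos_self[OF nat_pow_closed[OF x] A] ij(1) by simp
  then obtain a where a: "a \<in> A" "x [^] j = a \<otimes> x [^] i"
    unfolding r_coset_def by blast
  have "x [^] j = x [^] (j - i) \<otimes> x [^] i"
    using ij(2) x by (simp add: nat_pow_mult)
  then have "x [^] (j - i) = a"
    using a x subgroup.mem_carrier[OF A a(1)] by (metis nat_pow_closed right_cancel)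
  then show ?thesis
    using that[of "j - i"] ij(2) a(1) by simp
qed

lemma conj_int_pow:
  assumes "g \<in> carrier G" "x \<in> carrier G"
  shows "(g \<otimes> x \<otimes> inv g) [^] (k::int) = g \<otimes> x [^] k \<otimes> inv g"
proof -
  have "(\<lambda>y. g \<otimes> y \<otimes> inv g) \<in> hom G G"
    using assms(1) by (intro homI) (auto simp: m_assoc inv_solve_left)
  from hom_int_pow[OF this assms(2) is_group is_group, of k] show ?thesis by simp
qed

end

context group_action
begin

sublocale group G
  using group_hom by (simp add: group_hom_def)

lemma act_one: "x \<in> E \<Longrightarrow> \<phi> \<one> x = x"
  using id_eq_one by (metis restrict_apply')

lemma act_closed: "g \<in> carrier G \<Longrightarrow> x \<in> E \<Longrightarrow> \<phi> g x \<in> E"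
  using element_image by blast

lemma act_inv: "g \<in> carrier G \<Longrightarrow> x \<in> E \<Longrightarrow> \<phi> (inv g) (\<phi> g x) = x"
  using orbit_sym_aux by blast

lemma act_inv': "g \<in> carrier G \<Longrightarrow> x \<in> E \<Longrightarrow> \<phi> g (\<phi> (inv g) x) = x"
  using act_inv[of "inv g" x] by simp

lemma act_inj: "g \<in> carrier G \<Longrightarrow> x \<in> E \<Longrightarrow> y \<in> E \<Longrightarrow> \<phi> g x = \<phi> g y \<longleftrightarrow> x = y"
  using inj_prop by (meson inj_on_eq_iff)

lemma fixed_int_pow:
  assumes g: "g \<in> carrier G" and x: "x \<in> E" and fx: "\<phi> g x = x"
  shows "\<phi> (g [^] (k::int)) x = x"
proof -
  have n: "\<phi> (g [^] n) x = x" for n :: nat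
    by (induction n) (use assms in \<open>simp_all add: act_one composition_rule\<close>)
  show ?thesis
    unfolding int_pow_def2 using n act_inv[OF nat_pow_closed[OF g] x] by metis
qed

end

text \<open>The ping-pong table: each \<open>c i\<close> has its own territory \<open>I i\<close>, the territories are disjoint, and
  every non-trivial power of \<open>c i\<close> throws the outside of \<open>I i\<close> into \<open>I i\<close>.  The index set may be
  infinite.\<close>

locale ping_pong = group_action G E \<phi> for G (structure) and E and \<phi> +
  fixes c :: "'i \<Rightarrow> 'a" and I :: "'i \<Rightarrow> 'b set"
  assumes c_closed: "c i \<in> carrier G"
    and I_disjoint: "i \<noteq> j \<Longrightarrow> I i \<inter> I j = {}"
    and ping: "k \<noteq> 0 \<Longrightarrow> x \<in> E - I i \<Longrightarrow> \<phi> (c i [^] (k::int)) x \<in> I i"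
begin

text \<open>The first argument records the index of the leftmost syllable, so that the next syllable can be
  required to have a different one.\<close>

inductive reduced_word :: "'i option \<Rightarrow> 'a \<Rightarrow> bool" where
  empty: "reduced_word None \<one>"
| syllable: "reduced_word l g \<Longrightarrow> l \<noteq> Some i \<Longrightarrow> k \<noteq> 0 \<Longrightarrow>
    reduced_word (Some i) (c i [^] (k::int) \<otimes> g)"

lemma reduced_word_closed: "reduced_word l g \<Longrightarrow> g \<in> carrier G"
  by (induction rule: reduced_word.induct) (auto simp: c_closed)

lemma reduced_word_maps_into:
  assumes "reduced_word l g" "x \<in> E" "x \<notin> (\<Union>i. I i)"
  shows "case l of None \<Rightarrow> g = \<one> | Some i \<Rightarrow> \<phi> g x \<in> I i"
  using assms(1)
proof (induction rule: reduced_word.induct)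
  case (syllable l g i k)
  have g: "g \<in> carrier G" using syllable(1) by (rule reduced_word_closed)
  have "\<phi> g x \<notin> I i"
  proof (cases l)
    case None
    then show ?thesis using syllable(4) assms by (simp add: act_one)
  next
    case (Some j)
    then show ?thesis using syllable(2,4) I_disjoint[of i j] by auto
  qed
  then show ?case
    using ping[OF syllable(3)] g assms(2) c_closed by (simp add: composition_rule act_closed)
qed simp

lemma reduced_word_mult_power:
  assumes "reduced_word l g"
  shows "\<exists>l'. reduced_word l' (c i [^] (k::int) \<otimes> g)"
proof -
  have g: "g \<in> carrier G" using assms by (rule reduced_word_closed)
  show ?thesis
  proof (cases "k = 0")
    case True
    then show ?thesis using assms g by auto
  next
    case k: False
    show ?thesis
    proof (cases "l = Some i")
      case False
      then show ?thesis using reduced_word.syllable[OF assms False k] by blast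
    next
      case True
      with assms obtain l' g' m where w: "g = c i [^] (m::int) \<otimes> g'" "reduced_word l' g'" "l' \<noteq> Some i"
        by (auto elim: reduced_word.cases)
      have g': "g' \<in> carrier G" using w(2) by (rule reduced_word_closed)
      have "c i [^] k \<otimes> g = c i [^] (k + m) \<otimes> g'"
        using w(1) g' c_closed by (simp add: int_pow_mult m_assoc)
      then show ?thesis
        using w(2,3) g' reduced_word.syllable[OF w(2,3), of "k + m"] by (cases "k + m = 0") auto
    qed
  qed
qed

text \<open>Every element of the generated subgroup is a reduced word; the induction over \<^const>\<open>generate\<close>
  goes through because left multiplication by the subgroup preserves reduced words.\<close>

lemma generate_reduced_word:
  assumes "g \<in> generate G (range c)"
  obtains l where "reduced_word l g"
proof -
  have "\<exists>l'. reduced_word l' (g \<otimes> h)" if "reduced_word l h" for l h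
    using assms that
  proof (induction arbitrary: l h rule: generate.induct)
    case one
    then show ?case using reduced_word_closed[of l h] by auto
  next
    case (incl x)
    then show ?case
      using reduced_word_mult_power[where k = 1] c_closed by auto
  next
    case (inv x)
    then obtain i where "x = c i" by blast
    then have "inv x = c i [^] (-1::int)" using int_pow_neg[of "c i" 1] c_closed by simp
    then show ?case
      using reduced_word_mult_power[OF inv(2)] by metis
  next
    case (eng x y)
    obtain l' where l': "reduced_word l' (y \<otimes> h)" using eng by blast
    have "x \<in> carrier G" "y \<in> carrier G"
      using eng(1,2) generate_in_carrier[of "range c"] c_closed by blast+
    then show ?case
      using eng.IH(1)[OF l'] reduced_word_closed[OF eng(5)] by (simp add: m_assoc)
  qed
  from this[OF reduced_word.empty] obtain l where "reduced_word l (g \<otimes> \<one>)" by blast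
  moreover have "g \<in> carrier G"
    using assms generate_in_carrier[of "range c"] c_closed by blast
  ultimately show ?thesis using that by simp
qed

lemma generate_maps_into:
  assumes "g \<in> generate G (range c)" "g \<noteq> \<one>" "x \<in> E" "x \<notin> (\<Union>i. I i)"
  shows "\<phi> g x \<in> (\<Union>i. I i)"
proof -
  obtain l where "reduced_word l g" using generate_reduced_word[OF assms(1)] .
  from reduced_word_maps_into[OF this assms(3,4)] assms(2) show ?thesis
    by (cases l) auto
qed

text \<open>If two powers commuted, their product would throw a point outside of all territories into two
  disjoint territories at once.\<close>

lemma powers_do_not_commute:
  assumes "i \<noteq> j" "x \<in> E" "x \<notin> (\<Union>i. I i)" "m \<noteq> 0" "n \<noteq> 0"
  shows "c i [^] (m::int) \<otimes> c j [^] (n::int) \<noteq> c j [^] n \<otimes> c i [^] m"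
proof -
  have "\<phi> (c i [^] m) (\<phi> (c j [^] n) x) \<in> I i" if "i \<noteq> j" "m \<noteq> 0" "n \<noteq> 0" for i j and m n :: int
    using ping[of n x j] ping[of m "\<phi> (c j [^] n) x" i] I_disjoint[of i j] that assms(2,3)
      c_closed act_closed by auto
  from this[of i j m n] this[of j i n m] show ?thesis
    using assms I_disjoint[of i j] c_closed by (metis IntI composition_rule emptyE int_pow_closed)
qed

text \<open>A subgroup of finite index contains positive powers of two different generators, so it is not
  abelian.\<close>

lemma generate_not_virtually_abelian:
  fixes i j :: 'i
  assumes "i \<noteq> j" "x \<in> E" "x \<notin> (\<Union>i. I i)"
  shows "\<not> virtually_abelian (G\<lparr>carrier := generate G (range c)\<rparr>)"
proof
  let ?H = "G\<lparr>carrier := generate G (range c)\<rparr>"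
  have sub: "subgroup (generate G (range c)) G"
    using c_closed by (intro generate_is_subgroup) auto
  interpret H: group ?H
    using subgroup.subgroup_is_group[OF sub is_group] .
  assume "virtually_abelian ?H"
  then obtain A where A: "subgroup A ?H" "comm_group (?H\<lparr>carrier := A\<rparr>)" "finite (rcosets\<^bsub>?H\<^esub> A)"
    unfolding virtually_abelian_def by blast
  have "c i \<in> carrier ?H" for i by (simp add: generate.incl)
  note pow = H.power_in_finite_index_subgroup[OF A(1,3) this]
  obtain m :: nat where m: "m > 0" "c i [^]\<^bsub>?H\<^esub> m \<in> A" using pow .
  obtain n :: nat where n: "n > 0" "c j [^]\<^bsub>?H\<^esub> n \<in> A" using pow .
  have "c i [^] m \<in> A" "c j [^] n \<in> A"
    using m n nat_pow_consistent by auto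
  then have "c i [^] m \<otimes> c j [^] n = c j [^] n \<otimes> c i [^] m"
    using comm_groupE(4)[OF A(2)] by simp
  then show False
    using powers_do_not_commute[OF assms, of "int m" "int n"] m n by (simp add: int_pow_int)
qed

end

section \<open>Orientation-preserving isometries are disc automorphisms\<close>

text \<open>The matrix with rows \<open>(a, b)\<close> and \<open>(cnj b, cnj a)\<close> has determinant \<open>1\<close>, that is, it belongs
  to \<open>SU(1,1)\<close>; \<open>mob a b\<close> is its action by a linear fractional transformation.\<close>

definition su11 :: "complex \<Rightarrow> complex \<Rightarrow> bool" where
  "su11 a b \<longleftrightarrow> a * cnj a - b * cnj b = 1"

definition mob :: "complex \<Rightarrow> complex \<Rightarrow> complex \<Rightarrow> complex" where
  "mob a b z = (a * z + b) / (cnj b * z + cnj a)"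

lemma unit_mult_cnj: "cmod u = 1 \<Longrightarrow> u * cnj u = 1"
  by (metis complex_norm_square of_real_1 one_power2)

lemma su11_norm: "su11 a b \<Longrightarrow> (cmod a)\<^sup>2 = 1 + (cmod b)\<^sup>2"
proof -
  assume "su11 a b"
  then have "of_real ((cmod a)\<^sup>2) = (of_real (1 + (cmod b)\<^sup>2) :: complex)"
    unfolding su11_def by (simp only: of_real_add complex_norm_square of_real_1) (simp add: algebra_simps)
  then show ?thesis unfolding of_real_eq_iff .
qed

lemma su11_denominator:
  assumes "su11 a b" "cmod z \<le> 1"
  shows "cnj b * z + cnj a \<noteq> 0"
proof
  assume "cnj b * z + cnj a = 0"
  then have "cmod a = cmod (cnj b * z)"
    by (metis add.commute complex_mod_cnj eq_neg_iff_add_eq_0 norm_minus_cancel)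
  also have "\<dots> \<le> cmod b"
    using assms(2) by (simp add: norm_mult mult_left_le)
  finally have "(cmod a)\<^sup>2 \<le> (cmod b)\<^sup>2" by simp
  then show False using su11_norm[OF assms(1)] by simp
qed

lemma su11_inverse: "su11 a b \<Longrightarrow> su11 (cnj a) (- b)"
  by (simp add: su11_def mult.commute)

lemma su11_mult:
  assumes "su11 a b" "su11 c d"
  shows "su11 (a * c + b * cnj d) (a * d + b * cnj c)"
proof -
  have "(a * c + b * cnj d) * cnj (a * c + b * cnj d) - (a * d + b * cnj c) * cnj (a * d + b * cnj c)
     = (a * cnj a - b * cnj b) * (c * cnj c - d * cnj d)"
    by (simp add: algebra_simps)
  then show ?thesis using assms by (simp add: su11_def)
qed

lemma one_minus_norm_mob:
  assumes "su11 a b" "cmod z \<le> 1"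
  shows "1 - (cmod (mob a b z))\<^sup>2 = (1 - (cmod z)\<^sup>2) / (cmod (cnj b * z + cnj a))\<^sup>2"
proof -
  let ?d = "cnj b * z + cnj a"
  have d: "?d \<noteq> 0" by (rule su11_denominator[OF assms])
  have "?d * cnj ?d - (a * z + b) * cnj (a * z + b) = (a * cnj a - b * cnj b) * (1 - z * cnj z)"
    by (simp add: algebra_simps)
  then have "of_real ((cmod ?d)\<^sup>2 - (cmod (a * z + b))\<^sup>2) = (of_real (1 - (cmod z)\<^sup>2) :: complex)"
    using assms(1) unfolding su11_def by (simp only: of_real_diff complex_norm_square of_real_1) simp
  then have "(cmod ?d)\<^sup>2 - (cmod (a * z + b))\<^sup>2 = 1 - (cmod z)\<^sup>2"
    unfolding of_real_eq_iff .
  then show ?thesis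
    using d by (simp add: mob_def norm_divide power_divide field_simps)
qed

lemma norm_mob_less_1: "su11 a b \<Longrightarrow> cmod z < 1 \<Longrightarrow> cmod (mob a b z) < 1"
proof -
  assume a: "su11 a b" "cmod z < 1"
  then have "(cmod z)\<^sup>2 < 1" by (simp add: power_less_one_iff)
  then have "0 < (1 - (cmod z)\<^sup>2) / (cmod (cnj b * z + cnj a))\<^sup>2"
    using su11_denominator[of a b z] a by simp
  then have "(cmod (mob a b z))\<^sup>2 < 1"
    using one_minus_norm_mob[of a b z] a by simp
  then show ?thesis by (simp add: power_less_one_iff)
qed

lemma norm_mob_eq_1: "su11 a b \<Longrightarrow> cmod z = 1 \<Longrightarrow> cmod (mob a b z) = 1"
  using one_minus_norm_mob[of a b z] by (simp add: power2_eq_1_iff) (smt (verit) norm_ge_zero)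

lemma mob_diff:
  assumes "su11 a b" "cmod z \<le> 1" "cmod w \<le> 1"
  shows "mob a b z - mob a b w = (z - w) / ((cnj b * z + cnj a) * (cnj b * w + cnj a))"
proof -
  have "(a * z + b) * (cnj b * w + cnj a) - (a * w + b) * (cnj b * z + cnj a)
      = (a * cnj a - b * cnj b) * (z - w)"
    by (simp add: algebra_simps)
  then show ?thesis
    using su11_denominator[OF assms(1,2)] su11_denominator[OF assms(1,3)] assms(1)
    by (simp add: mob_def diff_frac_eq su11_def)
qed

lemma mob_mob:
  assumes "su11 a b" "su11 c d" "cmod z \<le> 1"
  shows "mob a b (mob c d z) = mob (a * c + b * cnj d) (a * d + b * cnj c) z"
proof -
  let ?e = "cnj d * z + cnj c"
  have e: "?e \<noteq> 0" by (rule su11_denominator[OF assms(2,3)])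
  have "mob a b (mob c d z)
      = ((a * (c * z + d) + b * ?e) / ?e) / ((cnj b * (c * z + d) + cnj a * ?e) / ?e)"
  proof -
    have "x * ((c * z + d) / ?e) + y = (x * (c * z + d) + y * ?e) / ?e" for x y
      by (subst add_divide_distrib) (simp add: e)
    then show ?thesis by (simp only: mob_def)
  qed
  also have "\<dots> = (a * (c * z + d) + b * ?e) / (cnj b * (c * z + d) + cnj a * ?e)"
    using e by simp
  also have "\<dots> = mob (a * c + b * cnj d) (a * d + b * cnj c) z"
    by (simp add: mob_def algebra_simps)
  finally show ?thesis .
qed

lemma mob_inverse:
  assumes "su11 a b" "cmod z \<le> 1"
  shows "mob (cnj a) (- b) (mob a b z) = z"
proof -
  have "cnj a * a + - b * cnj b = 1" "cnj a * b + - b * cnj a = 0"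
    using assms(1) by (simp_all add: su11_def mult.commute)
  then show ?thesis
    using mob_mob[OF su11_inverse[OF assms(1)] assms] by (simp add: mob_def)
qed

text \<open>This quantity is invariant under disc automorphisms, and the hyperbolic distance is an injective
  function of it.\<close>

definition dist_ratio :: "complex \<Rightarrow> complex \<Rightarrow> real" where
  "dist_ratio z w = (cmod (z - w))\<^sup>2 / ((1 - (cmod z)\<^sup>2) * (1 - (cmod w)\<^sup>2))"

lemma dist_ratio_mob:
  assumes "su11 a b" "cmod z < 1" "cmod w < 1"
  shows "dist_ratio (mob a b z) (mob a b w) = dist_ratio z w"
proof -
  have "cnj b * z + cnj a \<noteq> 0" "cnj b * w + cnj a \<noteq> 0"
    using su11_denominator[OF assms(1)] assms by auto
  then show ?thesis
    using assms mob_diff[of a b z w] one_minus_norm_mob[of a b z] one_minus_norm_mob[of a b w]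
    by (simp add: dist_ratio_def norm_divide norm_mult power_divide power_mult_distrib)
qed

lemma hyp_dist_eq_imp_dist_ratio_eq:
  assumes "hyp_dist z w = hyp_dist z' w'" "{z, w, z', w'} \<subseteq> hyp_plane"
  shows "dist_ratio z w = dist_ratio z' w'"
proof -
  have nonneg: "0 \<le> dist_ratio u v" if "u \<in> hyp_plane" "v \<in> hyp_plane" for u v
    using that unfolding dist_ratio_def
    by (intro divide_nonneg_nonneg mult_nonneg_nonneg) (auto simp: power_le_one)
  have "1 + 2 * dist_ratio u v = cosh (hyp_dist u v)" if "u \<in> hyp_plane" "v \<in> hyp_plane" for u v
    using nonneg[OF that] unfolding hyp_dist_def
    by (subst cosh_arcosh_real) (simp_all add: dist_ratio_def)
  from this[of z w] this[of z' w'] show ?thesis using assms by simp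
qed

text \<open>Such an \<open>F\<close> preserves inner products, so it is determined by its values at the linearly
  independent points \<open>1/2\<close> and \<open>\<i>/2\<close>.  A rotation makes it fix the first, and then the second can only
  go to itself or to its negative.\<close>

lemma disc_isometry_fixing_0:
  fixes F :: "complex \<Rightarrow> complex"
  assumes norm: "\<And>z. cmod z < 1 \<Longrightarrow> cmod (F z) = cmod z"
    and dist: "\<And>z w. cmod z < 1 \<Longrightarrow> cmod w < 1 \<Longrightarrow> cmod (F z - F w) = cmod (z - w)"
  obtains c where "cmod c = 1"
    "(\<forall>z. cmod z < 1 \<longrightarrow> F z = c * z) \<or> (\<forall>z. cmod z < 1 \<longrightarrow> F z = c * cnj z)"
proof -
  have inner: "F z \<bullet> F w = z \<bullet> w" if "cmod z < 1" "cmod w < 1" for z w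
    using dist[OF that] norm[OF that(1)] norm[OF that(2)] by (simp add: dot_norm_neg)
  define c where "c = 2 * F (1/2)"
  have c: "cmod c = 1" using norm[of "1/2"] by (simp add: c_def norm_mult)
  then have cc: "c * cnj c = 1" by (rule unit_mult_cnj)
  define g where "g z = cnj c * F z" for z
  have Fg: "F z = c * g z" for z
    using cc by (simp add: g_def mult.assoc[symmetric])
  have g_inner: "g z \<bullet> g w = z \<bullet> w" if "cmod z < 1" "cmod w < 1" for z w
  proof -
    have "g z \<bullet> g w = Re (g z * cnj (g w))" by (simp add: inner_complex_def)
    also have "g z * cnj (g w) = (c * cnj c) * (F z * cnj (F w))" by (simp add: g_def)
    also have "Re \<dots> = F z \<bullet> F w" by (simp add: cc inner_complex_def)
    finally show ?thesis using inner[OF that] by simp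
  qed
  have half: "g (1/2) = 1/2"
    using cc by (simp add: g_def c_def mult.commute)
  have Re: "Re (g z) = Re z" if "cmod z < 1" for z
    using g_inner[of z "1/2"] that by (simp add: half inner_complex_def)
  have Im: "Im (g z) * Im (g w) = Im z * Im w" if "cmod z < 1" "cmod w < 1" for z w
    using g_inner[OF that] Re that by (simp add: inner_complex_def)
  have i: "cmod (\<i>/2) < 1" by (simp add: norm_divide)
  define e where "e = 2 * Im (g (\<i>/2))"
  have "e * e = 1" using Im[OF i i] by (simp add: e_def)
  then have e: "e = 1 \<or> e = -1" by (simp add: square_eq_1_iff)
  have "Im (g z) = e * Im z" if "cmod z < 1" for z
  proof -
    have "Im (g z) * e = Im z" using Im[OF that i] by (simp add: e_def)
    then show ?thesis using e by auto
  qed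
  then have "(\<forall>z. cmod z < 1 \<longrightarrow> g z = z) \<or> (\<forall>z. cmod z < 1 \<longrightarrow> g z = cnj z)"
    using e Re by (auto simp: complex_eq_iff)
  then show ?thesis using that[OF c] Fg by auto
qed

lemma mob_has_derivative:
  assumes "su11 a b" "cmod z < 1"
  shows "\<exists>D. (mob a b has_field_derivative D) (at z)"
  using su11_denominator[OF assms(1), of z] assms(2)
  unfolding mob_def[abs_def] by (auto intro!: derivative_eq_intros exI)

text \<open>After moving \<open>f 0\<close> to the centre, \<open>f\<close> becomes a rotation or a reflection; a reflection is
  excluded by the sign of its Jacobian at \<open>0\<close>.\<close>

lemma Isom_plus_mob:
  assumes f: "f \<in> carrier Isom_plus"
  obtains a b where "su11 a b" "\<And>z. cmod z < 1 \<Longrightarrow> f z = mob a b z"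
proof -
  have maps: "cmod (f z) < 1" if "cmod z < 1" for z
    using f that Bij_imp_funcset[of f hyp_plane] by (auto simp: Isom_plus_def)
  have ratio: "dist_ratio (f z) (f w) = dist_ratio z w" if "cmod z < 1" "cmod w < 1" for z w
    using f maps that by (intro hyp_dist_eq_imp_dist_ratio_eq) (auto simp: Isom_plus_def)
  define t where "t = f 0"
  have t: "cmod t < 1" using maps[of 0] by (simp add: t_def)
  \<comment> \<open>\<open>s\<close> normalises the automorphism \<open>mob a b\<close> that moves \<open>t\<close> to \<open>0\<close>\<close>
  define s where "s = 1 / sqrt (1 - (cmod t)\<^sup>2)"
  have t2: "(cmod t)\<^sup>2 < 1" using t by (simp add: power_less_one_iff)
  then have s2: "s\<^sup>2 * (1 - (cmod t)\<^sup>2) = 1" and s: "s > 0"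
    by (simp_all add: s_def power_divide)
  define a where "a = complex_of_real s"
  define b where "b = - of_real s * t"
  have su: "su11 a b"
  proof -
    have "a * cnj a - b * cnj b = of_real (s\<^sup>2 * (1 - (cmod t)\<^sup>2))"
      by (simp only: of_real_mult of_real_diff complex_norm_square)
        (simp add: a_def b_def power2_eq_square algebra_simps)
    then show ?thesis using s2 by (simp add: su11_def)
  qed
  define F where "F z = mob a b (f z)" for z
  have F1: "cmod (F z) < 1" if "cmod z < 1" for z
    unfolding F_def by (rule norm_mob_less_1[OF su maps[OF that]])
  have F0: "F 0 = 0" by (simp add: F_def mob_def a_def b_def t_def)
  have F_ratio: "dist_ratio (F z) (F w) = dist_ratio z w" if "cmod z < 1" "cmod w < 1" for z w
    unfolding F_def using dist_ratio_mob[OF su maps maps] ratio that by simp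
  have F_norm: "cmod (F z) = cmod z" if z: "cmod z < 1" for z
  proof -
    have "(cmod (F z))\<^sup>2 < 1" "(cmod z)\<^sup>2 < 1"
      using F1[OF z] z by (simp_all add: power_less_one_iff)
    moreover have "(cmod (F z))\<^sup>2 / (1 - (cmod (F z))\<^sup>2) = (cmod z)\<^sup>2 / (1 - (cmod z)\<^sup>2)"
      using F_ratio[OF z, of 0] by (simp add: F0 dist_ratio_def)
    ultimately have "(cmod (F z))\<^sup>2 = (cmod z)\<^sup>2" by (simp add: field_simps)
    then show ?thesis by simp
  qed
  have F_dist: "cmod (F z - F w) = cmod (z - w)" if "cmod z < 1" "cmod w < 1" for z w
  proof -
    have "(cmod z)\<^sup>2 < 1" "(cmod w)\<^sup>2 < 1"
      using that by (simp_all add: power_less_one_iff)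
    then have "(cmod (F z - F w))\<^sup>2 = (cmod (z - w))\<^sup>2"
      using F_ratio[OF that] F_norm that by (simp add: dist_ratio_def)
    then show ?thesis by simp
  qed
  have f_F: "f z = mob (cnj a) (- b) (F z)" if "cmod z < 1" for z
    unfolding F_def using mob_inverse[OF su] maps[OF that] by simp
  obtain c where c: "cmod c = 1"
    and cases: "(\<forall>z. cmod z < 1 \<longrightarrow> F z = c * z) \<or> (\<forall>z. cmod z < 1 \<longrightarrow> F z = c * cnj z)"
    using disc_isometry_fixing_0[OF F_norm F_dist] by blast
  from cases show ?thesis
  proof
    assume rot: "\<forall>z. cmod z < 1 \<longrightarrow> F z = c * z"
    \<comment> \<open>the rotation by \<open>c\<close> is \<open>mob d 0\<close> for a square root \<open>d\<close> of \<open>c\<close>\<close>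
    define d where "d = csqrt c"
    have d: "d * d = c" by (simp add: d_def flip: power2_eq_square)
    have "cmod d = 1" using c by (simp add: d_def)
    then have dd: "d * cnj d = 1" by (rule unit_mult_cnj)
    then have sud: "su11 d 0" by (simp add: su11_def)
    have "mob d 0 z = c * z" for z
    proof -
      have "c * z * cnj d = d * z * (d * cnj d)" by (simp flip: d)
      moreover have "cnj d \<noteq> 0" using dd by auto
      ultimately show ?thesis using dd by (auto simp: mob_def divide_eq_eq)
    qed
    then have "f z = mob (cnj a) (- b) (mob d 0 z)" if "cmod z < 1" for z
      using f_F rot that by simp
    then show ?thesis
      using that[OF su11_mult[OF su11_inverse[OF su] sud]] mob_mob[OF su11_inverse[OF su] sud]
      by simp
  next
    assume refl: "\<forall>z. cmod z < 1 \<longrightarrow> F z = c * cnj z"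
    obtain D where D: "(mob (cnj a) (- b) has_field_derivative D) (at (c * cnj 0))"
      using mob_has_derivative[OF su11_inverse[OF su], of 0] by auto
    have "((\<lambda>z. c * cnj z) has_derivative (\<lambda>h. c * cnj h)) (at 0)"
      by (intro has_derivative_mult_right has_derivative_cnj has_derivative_ident)
    from has_derivative_compose[OF this D[unfolded has_field_derivative_def]]
    have "((\<lambda>z. mob (cnj a) (- b) (c * cnj z)) has_derivative (\<lambda>h. D * (c * cnj h))) (at 0)" .
    then have f': "(f has_derivative (\<lambda>h. D * (c * cnj h))) (at 0)"
      by (rule has_derivative_transform_within_open[of _ _ _ _ hyp_plane]) (simp_all add: f_F refl)
    obtain L where L: "(f has_derivative L) (at 0)" "jac_det L > 0"
      using f unfolding Isom_plus_def orientation_preserving_def by force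
    have "(\<lambda>h. D * (c * cnj h)) = L"
      by (rule has_derivative_unique[OF f' L(1)])
    then have "jac_det (\<lambda>h. D * (c * cnj h)) > 0"
      using L(2) by simp
    moreover have "jac_det (\<lambda>h. D * (c * cnj h)) = - (Re (D * c))\<^sup>2 - (Im (D * c))\<^sup>2"
      by (simp add: jac_det_def power2_eq_square algebra_simps)
    ultimately have False
      using zero_le_power2[of "Re (D * c)"] zero_le_power2[of "Im (D * c)"] by linarith
    then show ?thesis ..
  qed
qed

section \<open>The action on the circle at infinity\<close>

text \<open>The continuous extension of \<open>f\<close> to the circle.  It is undefined elsewhere, because the elements
  of \<^const>\<open>BijGroup\<close> are extensional.\<close>

definition bdry :: "(complex \<Rightarrow> complex) \<Rightarrow> complex \<Rightarrow> complex" where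
  "bdry f = (\<lambda>\<xi>\<in>circle_at_infinity. Lim (at \<xi> within hyp_plane) f)"

lemma mob_tendsto_boundary:
  assumes su: "su11 a b" and f: "\<And>z. cmod z < 1 \<Longrightarrow> f z = mob a b z" and \<xi>: "cmod \<xi> = 1"
  shows "(f \<longlongrightarrow> mob a b \<xi>) (at \<xi> within hyp_plane)"
proof -
  have "isCont (mob a b) \<xi>"
    unfolding mob_def[abs_def] using su11_denominator[OF su, of \<xi>] \<xi>
    by (intro continuous_intros) auto
  then have "(mob a b \<longlongrightarrow> mob a b \<xi>) (at \<xi> within hyp_plane)"
    using continuous_at_imp_continuous_at_within[of \<xi> "mob a b" hyp_plane] by (simp add: continuous_within)
  moreover have "\<forall>\<^sub>F z in at \<xi> within hyp_plane. mob a b z = f z"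
    by (auto simp: eventually_at_filter f)
  ultimately show ?thesis by (rule Lim_transform_eventually)
qed

lemma boundary_nontrivial_limit: "cmod \<xi> = 1 \<Longrightarrow> at \<xi> within hyp_plane \<noteq> bot"
  using trivial_limit_within[of \<xi> hyp_plane] by (simp add: islimpt_ball)

lemma bdry_mob:
  assumes "su11 a b" "\<And>z. cmod z < 1 \<Longrightarrow> f z = mob a b z" "cmod \<xi> = 1"
  shows "bdry f \<xi> = mob a b \<xi>"
  unfolding bdry_def
  using tendsto_Lim[OF boundary_nontrivial_limit mob_tendsto_boundary, OF assms(3) assms] assms(3)
  by simp

lemma Isom_plus_mult:
  assumes "f \<in> carrier Isom_plus" "g \<in> carrier Isom_plus" "cmod z < 1"
  shows "(f \<otimes>\<^bsub>Isom_plus\<^esub> g) z = f (g z)"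
  using assms by (simp add: Isom_plus_def BijGroup_def compose_def)

lemma Isom_plus_one: "cmod z < 1 \<Longrightarrow> \<one>\<^bsub>Isom_plus\<^esub> z = z"
  by (simp add: Isom_plus_def BijGroup_def)

lemma Isom_plus_eqI:
  assumes "f \<in> carrier Isom_plus" "g \<in> carrier Isom_plus" "\<And>z. cmod z < 1 \<Longrightarrow> f z = g z"
  shows "f = g"
proof (rule extensionalityI[of _ hyp_plane])
  show "f \<in> extensional hyp_plane" "g \<in> extensional hyp_plane"
    using assms by (auto simp: Isom_plus_def Bij_imp_extensional)
qed (use assms in auto)

interpretation Isom: group Isom_plus
  by (rule group_Isom_plus)

lemma Isom_plus_eq_one:
  assumes "f \<in> carrier Isom_plus" "\<And>z. cmod z < 1 \<Longrightarrow> f z = mob a b z" "b = 0" "a = 1 \<or> a = -1"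
  shows "f = \<one>\<^bsub>Isom_plus\<^esub>"
  using assms by (intro Isom_plus_eqI) (auto simp: Isom_plus_one mob_def)

lemma bdry_in_Bij:
  assumes "f \<in> carrier Isom_plus"
  shows "bdry f \<in> Bij circle_at_infinity"
proof -
  obtain a b where ab: "su11 a b" "\<And>z. cmod z < 1 \<Longrightarrow> f z = mob a b z"
    using Isom_plus_mob[OF assms] by blast
  have eq: "bdry f \<xi> = mob a b \<xi>" if "cmod \<xi> = 1" for \<xi>
    by (rule bdry_mob[OF ab that])
  have "bij_betw (bdry f) circle_at_infinity circle_at_infinity"
  proof (rule bij_betw_byWitness[where f' = "mob (cnj a) (- b)"])
    show "\<forall>\<xi>\<in>circle_at_infinity. mob (cnj a) (- b) (bdry f \<xi>) = \<xi>"
      using mob_inverse[OF ab(1)] by (simp add: eq)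
    show "\<forall>\<xi>\<in>circle_at_infinity. bdry f (mob (cnj a) (- b) \<xi>) = \<xi>"
      using mob_inverse[OF su11_inverse[OF ab(1)]] norm_mob_eq_1[OF su11_inverse[OF ab(1)]]
      by (simp add: eq)
  qed (use eq norm_mob_eq_1[OF ab(1)] norm_mob_eq_1[OF su11_inverse[OF ab(1)]] in auto)
  then show ?thesis by (simp add: Bij_def bdry_def)
qed

interpretation bdry: group_action Isom_plus circle_at_infinity bdry
proof (intro group_action.intro group_hom.intro group_hom_axioms.intro homI)
  show "bdry (f \<otimes>\<^bsub>Isom_plus\<^esub> g) = bdry f \<otimes>\<^bsub>BijGroup circle_at_infinity\<^esub> bdry g"
    if f: "f \<in> carrier Isom_plus" and g: "g \<in> carrier Isom_plus" for f g
  proof -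
    obtain a b where ab: "su11 a b" "\<And>z. cmod z < 1 \<Longrightarrow> f z = mob a b z"
      using Isom_plus_mob[OF f] by blast
    obtain c d where cd: "su11 c d" "\<And>z. cmod z < 1 \<Longrightarrow> g z = mob c d z"
      using Isom_plus_mob[OF g] by blast
    have "(f \<otimes>\<^bsub>Isom_plus\<^esub> g) z = mob (a * c + b * cnj d) (a * d + b * cnj c) z" if "cmod z < 1" for z
      using Isom_plus_mult[OF f g that] mob_mob[OF ab(1) cd(1), of z] ab(2) cd(2) that
        norm_mob_less_1[OF cd(1) that] by simp
    then have "bdry (f \<otimes>\<^bsub>Isom_plus\<^esub> g) \<xi> = bdry f (bdry g \<xi>)" if "\<xi> \<in> circle_at_infinity" for \<xi>
      using that bdry_mob[OF su11_mult[OF ab(1) cd(1)]] bdry_mob[OF ab] bdry_mob[OF cd]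
        mob_mob[OF ab(1) cd(1)] norm_mob_eq_1[OF cd(1)] by simp
    moreover have "bdry h \<in> extensional circle_at_infinity" for h
      by (simp add: bdry_def)
    ultimately show ?thesis
      using bdry_in_Bij[OF f] bdry_in_Bij[OF g]
      by (auto simp: BijGroup_def compose_def restrict_def extensional_def)
  qed
  show "bdry f \<in> carrier (BijGroup circle_at_infinity)" if "f \<in> carrier Isom_plus" for f
    using bdry_in_Bij[OF that] by (simp add: BijGroup_def)
qed (rule Isom.is_group group_BijGroup)+

lemma ideal_fixed_points_bdry:
  assumes "f \<in> carrier Isom_plus"
  shows "ideal_fixed_points f = {\<xi>\<in>circle_at_infinity. bdry f \<xi> = \<xi>}"
proof -
  obtain a b where ab: "su11 a b" "\<And>z. cmod z < 1 \<Longrightarrow> f z = mob a b z"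
    using Isom_plus_mob[OF assms] by blast
  have "(f \<longlongrightarrow> \<xi>) (at \<xi> within hyp_plane) \<longleftrightarrow> bdry f \<xi> = \<xi>" if "cmod \<xi> = 1" for \<xi>
    using tendsto_unique[OF boundary_nontrivial_limit[OF that]] mob_tendsto_boundary[OF ab that]
      bdry_mob[OF ab that] by metis
  then show ?thesis by (auto simp: ideal_fixed_points_def)
qed

section \<open>Multipliers at fixed points\<close>

text \<open>The multiplier \<open>cnj b * p + cnj a\<close> of a fixed point on the circle is real since disc
  automorphisms send \<open>p\<close> on the circle to \<open>p * cnj l / l\<close>, where \<open>l\<close> is this number.\<close>

lemma mob_fixed_point:
  assumes "su11 a b" "cmod p = 1" "mob a b p = p"
  shows "a * p + b = (cnj b * p + cnj a) * p" "Im (cnj b * p + cnj a) = 0"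
proof -
  let ?l = "cnj b * p + cnj a"
  show 1: "a * p + b = ?l * p"
    using assms su11_denominator[of a b p] by (simp add: mob_def divide_eq_eq mult.commute)
  have pp: "p * cnj p = 1" using assms(2) by (rule unit_mult_cnj)
  have "cnj ?l * p = b * (p * cnj p) + a * p" by (simp add: algebra_simps)
  also have "\<dots> = ?l * p" using 1 pp by (simp add: add.commute)
  finally have "cnj ?l = ?l" using assms(2) by auto
  then show "Im ?l = 0" by (metis Reals_cnj_iff complex_is_Real_iff)
qed

text \<open>\<open>f\<close> is induced by a matrix in \<open>SU(1,1)\<close> that has \<open>(p, 1)\<close> as an eigenvector with eigenvalue
  \<open>l\<close>.\<close>

definition multiplier :: "(complex \<Rightarrow> complex) \<Rightarrow> complex \<Rightarrow> complex \<Rightarrow> bool" where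
  "multiplier f p l \<longleftrightarrow> (\<exists>a b. su11 a b \<and> (\<forall>z. cmod z < 1 \<longrightarrow> f z = mob a b z) \<and>
     a * p + b = l * p \<and> cnj b * p + cnj a = l)"

lemma multiplier_exists:
  assumes "f \<in> carrier Isom_plus" "cmod p = 1" "bdry f p = p"
  obtains l where "multiplier f p l" "l \<noteq> 0"
proof -
  obtain a b where ab: "su11 a b" "\<And>z. cmod z < 1 \<Longrightarrow> f z = mob a b z"
    using Isom_plus_mob[OF assms(1)] by blast
  then have "mob a b p = p" using bdry_mob[OF ab assms(2)] assms(3) by simp
  from mob_fixed_point(1)[OF ab(1) assms(2) this] ab
  have "multiplier f p (cnj b * p + cnj a)" unfolding multiplier_def by blast
  then show ?thesis using that su11_denominator[OF ab(1), of p] assms(2) by auto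
qed

lemma multiplier_mult:
  assumes f: "f \<in> carrier Isom_plus" and g: "g \<in> carrier Isom_plus"
    and "multiplier f p l" "multiplier g p m"
  shows "multiplier (f \<otimes>\<^bsub>Isom_plus\<^esub> g) p (l * m)"
proof -
  obtain a b where ab: "su11 a b" "\<And>z. cmod z < 1 \<Longrightarrow> f z = mob a b z"
    "a * p + b = l * p" "cnj b * p + cnj a = l"
    using assms(3) unfolding multiplier_def by blast
  obtain c d where cd: "su11 c d" "\<And>z. cmod z < 1 \<Longrightarrow> g z = mob c d z"
    "c * p + d = m * p" "cnj d * p + cnj c = m"
    using assms(4) unfolding multiplier_def by blast
  have "(f \<otimes>\<^bsub>Isom_plus\<^esub> g) z = mob (a * c + b * cnj d) (a * d + b * cnj c) z" if "cmod z < 1" for z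
    using Isom_plus_mult[OF f g that] mob_mob[OF ab(1) cd(1), of z] ab(2) cd(2) that
      norm_mob_less_1[OF cd(1) that] by simp
  moreover have "(a * c + b * cnj d) * p + (a * d + b * cnj c) = l * m * p"
  proof -
    have "(a * c + b * cnj d) * p + (a * d + b * cnj c)
        = a * (c * p + d) + b * (cnj d * p + cnj c)" by (simp add: algebra_simps)
    also have "\<dots> = m * (a * p + b)" unfolding cd(3,4) by (simp add: algebra_simps)
    finally show ?thesis unfolding ab(3) by (simp add: algebra_simps)
  qed
  moreover have "cnj (a * d + b * cnj c) * p + cnj (a * c + b * cnj d) = l * m"
  proof -
    have "cnj (a * d + b * cnj c) * p + cnj (a * c + b * cnj d)
        = cnj b * (c * p + d) + cnj a * (cnj d * p + cnj c)" by (simp add: algebra_simps)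
    also have "\<dots> = m * (cnj b * p + cnj a)" unfolding cd(3,4) by (simp add: algebra_simps)
    finally show ?thesis unfolding ab(4) by (simp add: algebra_simps)
  qed
  ultimately show ?thesis
    unfolding multiplier_def using su11_mult[OF ab(1) cd(1)] by blast
qed

lemma multiplier_inv:
  assumes f: "f \<in> carrier Isom_plus" and "multiplier f p l"
  shows "multiplier (inv\<^bsub>Isom_plus\<^esub> f) p (inverse l)"
proof -
  obtain a b where ab: "su11 a b" "\<And>z. cmod z < 1 \<Longrightarrow> f z = mob a b z"
    "a * p + b = l * p" "cnj b * p + cnj a = l"
    using assms(2) unfolding multiplier_def by blast
  have det: "a * cnj a - b * cnj b = 1" using ab(1) by (simp add: su11_def)
  note fi = Isom.inv_closed[OF f]
  have "(inv\<^bsub>Isom_plus\<^esub> f) z = mob (cnj a) (- b) z" if z: "cmod z < 1" for z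
  proof -
    let ?w = "mob (cnj a) (- b) z"
    have w: "cmod ?w < 1" by (rule norm_mob_less_1[OF su11_inverse[OF ab(1)] z])
    have "f ?w = z"
      using ab(2)[OF w] mob_inverse[OF su11_inverse[OF ab(1)], of z] z by simp
    then have "(inv\<^bsub>Isom_plus\<^esub> f) z = (inv\<^bsub>Isom_plus\<^esub> f \<otimes>\<^bsub>Isom_plus\<^esub> f) ?w"
      using Isom_plus_mult[OF fi f w] by simp
    also have "\<dots> = ?w" using f w by (simp add: Isom_plus_one)
    finally show ?thesis .
  qed
  moreover have l1: "(a - cnj b * p) * l = 1"
  proof -
    have "(a - cnj b * p) * l = a * (cnj b * p + cnj a) - cnj b * (l * p)"
      using ab(4) by (simp add: algebra_simps)
    also have "\<dots> = a * (cnj b * p + cnj a) - cnj b * (a * p + b)" using ab(3) by simp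
    also have "\<dots> = a * cnj a - b * cnj b" by (simp add: algebra_simps)
    finally show ?thesis using det by simp
  qed
  moreover have "(cnj a * p - b) * l = p"
  proof -
    have "(cnj a * p - b) * l = cnj a * (l * p) - b * l" by (simp add: algebra_simps)
    also have "\<dots> = cnj a * (a * p + b) - b * (cnj b * p + cnj a)" using ab(3,4) by simp
    also have "\<dots> = (a * cnj a - b * cnj b) * p" by (simp add: algebra_simps)
    finally show ?thesis using det by simp
  qed
  moreover have "l \<noteq> 0" using l1 by auto
  ultimately show ?thesis
    unfolding multiplier_def using su11_inverse[OF ab(1)]
    by (intro exI[of _ "cnj a"] exI[of _ "- b"]) (auto simp: field_simps)
qed

text \<open>The fixed points of a disc automorphism \<open>f \<noteq> \<one>\<close> have reciprocal multipliers.  If \<open>p\<close> has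
  multiplier \<open>1\<close>, then a second fixed point would have it as well, and the denominator
  \<open>cnj b * z + cnj a\<close> would take the value \<open>1\<close> twice, which forces
  \<open>f = \<one>\<close>.\<close>

lemma parabolic_if_multiplier_1:
  assumes f: "f \<in> carrier Isom_plus" "f \<noteq> \<one>\<^bsub>Isom_plus\<^esub>" and p: "cmod p = 1"
    and "multiplier f p 1"
  shows "parabolic f"
proof -
  obtain a b where ab: "su11 a b" "\<And>z. cmod z < 1 \<Longrightarrow> f z = mob a b z"
    "a * p + b = p" "cnj b * p + cnj a = 1"
    using assms(4) unfolding multiplier_def by auto
  have b: "b \<noteq> 0"
  proof
    assume "b = 0"
    then have "a = 1" using ab(4) by simp
    then show False using Isom_plus_eq_one[OF f(1) ab(2) \<open>b = 0\<close>] f(2) by blast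
  qed
  have fixp: "mob a b p = p" using ab(3,4) by (simp add: mob_def)
  have uniq: "z = p" if z: "cmod z \<le> 1" "mob a b z = z" for z
  proof (rule ccontr)
    assume "z \<noteq> p"
    moreover have "z - p = (z - p) / (cnj b * z + cnj a)"
      using mob_diff[OF ab(1) z(1), of p] p fixp z(2) ab(4) by simp
    moreover from this have "(z - p) * (cnj b * z + cnj a) = z - p"
      using su11_denominator[OF ab(1) z(1)] by (metis nonzero_eq_divide_eq)
    ultimately have "cnj b * z + cnj a = 1"
      by (metis eq_iff_diff_eq_0 mult_cancel_left mult.right_neutral)
    moreover have "cnj b * (z - p) = (cnj b * z + cnj a) - (cnj b * p + cnj a)"
      by (simp add: algebra_simps)
    ultimately have "cnj b * (z - p) = 0" using ab(4) by simp
    then show False using b \<open>z \<noteq> p\<close> by simp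
  qed
  have "ideal_fixed_points f = {p}"
    using uniq fixp p bdry_mob[OF ab(1,2)] by (auto simp: ideal_fixed_points_bdry[OF f(1)])
  moreover have "f z \<noteq> z" if "z \<in> hyp_plane" for z
    using uniq[of z] that ab(2)[of z] p by auto
  ultimately show ?thesis using f by (simp add: parabolic_def)
qed

text \<open>Normalised coordinate that sends \<open>p\<close> to \<open>0\<close> and \<open>q\<close> to infinity; the isometries fixing \<open>p\<close>
  and \<open>q\<close> become multiplications by positive numbers.  As division by \<open>0\<close> yields \<open>0\<close>, the coordinate
  also vanishes at \<open>q\<close>.\<close>

definition coord :: "complex \<Rightarrow> complex \<Rightarrow> complex \<Rightarrow> complex" where
  "coord p q z = (z - p) / (z - q)"

lemma axis_coord:
  assumes f: "f \<in> carrier Isom_plus" "f \<noteq> \<one>\<^bsub>Isom_plus\<^esub>"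
    and pq: "p \<noteq> q" "cmod p = 1" "cmod q = 1" "bdry f p = p" "bdry f q = q"
  obtains k :: real where "k > 0" "k \<noteq> 1"
    "\<And>\<xi>. cmod \<xi> = 1 \<Longrightarrow> coord p q (bdry f \<xi>) = of_real k * coord p q \<xi>"
    "\<And>z. cmod z < 1 \<Longrightarrow> coord p q (f z) = of_real k * coord p q z"
proof -
  obtain a b where ab: "su11 a b" "\<And>z. cmod z < 1 \<Longrightarrow> f z = mob a b z"
    using Isom_plus_mob[OF f(1)] by blast
  have fp: "mob a b p = p" "mob a b q = q"
    using bdry_mob[OF ab] pq by auto
  define d where "d z = cnj b * z + cnj a" for z
  have d0: "d z \<noteq> 0" if "cmod z \<le> 1" for z
    unfolding d_def by (rule su11_denominator[OF ab(1) that])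
  have "p - q = (p - q) / (d p * d q)"
    using mob_diff[OF ab(1), of p q] fp pq by (simp add: d_def)
  then have "(p - q) * (d p * d q) = p - q"
    using d0[of p] d0[of q] pq by (simp add: eq_divide_eq)
  then have dpq: "d p * d q = 1"
    using pq(1) by (metis eq_iff_diff_eq_0 mult_cancel_left mult.right_neutral)
  obtain r where r: "d q = of_real r"
    using mob_fixed_point(2)[OF ab(1) pq(3) fp(2)] complex_is_Real_iff
    by (metis Reals_cases d_def)
  have r0: "r \<noteq> 0" using r d0[of q] pq by auto
  have dp: "d p = of_real (1 / r)"
    using dpq r0 unfolding r by (simp add: field_simps)
  have coord: "coord p q (mob a b z) = of_real (r\<^sup>2) * coord p q z" if z: "cmod z \<le> 1" for z
  proof -
    have "mob a b z - p = (z - p) / (d z * d p)" "mob a b z - q = (z - q) / (d z * d q)"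
      using mob_diff[OF ab(1) z, of p] mob_diff[OF ab(1) z, of q] fp pq by (simp_all add: d_def)
    then show ?thesis
      using d0[OF z] r0 by (simp add: coord_def r dp power2_eq_square)
  qed
  have "r\<^sup>2 \<noteq> 1"
  proof
    assume "r\<^sup>2 = 1"
    then have r1: "r = 1 \<or> r = -1" by (simp add: power2_eq_1_iff)
    then have "d p = d q" using r dp by auto
    then have "b = 0" using pq(1) by (simp add: d_def)
    moreover have "a = 1 \<or> a = -1"
      using r r1 \<open>b = 0\<close> unfolding d_def
      by (metis add_0 complex_cnj_cnj complex_cnj_complex_of_real complex_cnj_zero mult_zero_left of_real_1 of_real_minus)
    ultimately show False using Isom_plus_eq_one[OF f(1) ab(2)] f(2) by blast
  qed
  moreover have "r\<^sup>2 > 0" using r0 by simp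
  ultimately show ?thesis
    using that[of "r\<^sup>2"] coord bdry_mob[OF ab] ab(2) by simp
qed

lemma coord_eq_0_iff: "coord p q z = 0 \<longleftrightarrow> z = p \<or> z = q"
  by (auto simp: coord_def)

lemma two_fixed_points_loxodromic:
  assumes f: "f \<in> carrier Isom_plus" "f \<noteq> \<one>\<^bsub>Isom_plus\<^esub>"
    and pq: "p \<noteq> q" "cmod p = 1" "cmod q = 1" "bdry f p = p" "bdry f q = q"
  shows "loxodromic f" "ideal_fixed_points f = {p, q}"
proof -
  obtain k :: real where k: "k > 0" "k \<noteq> 1"
    "\<And>\<xi>. cmod \<xi> = 1 \<Longrightarrow> coord p q (bdry f \<xi>) = of_real k * coord p q \<xi>"
    "\<And>z. cmod z < 1 \<Longrightarrow> coord p q (f z) = of_real k * coord p q z"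
    using axis_coord[OF assms] by blast
  have "z = p \<or> z = q" if "coord p q z = of_real k * coord p q z" for z
    using that k(2) by (metis coord_eq_0_iff mult_cancel_right1 of_real_eq_1_iff)
  note * = this
  have "\<xi> = p \<or> \<xi> = q" if "cmod \<xi> = 1" "bdry f \<xi> = \<xi>" for \<xi>
    using *[of \<xi>] k(3)[of \<xi>] that by simp
  then show ifp: "ideal_fixed_points f = {p, q}"
    using pq by (auto simp: ideal_fixed_points_bdry[OF f(1)])
  have "f z \<noteq> z" if "z \<in> hyp_plane" for z
    using *[of z] k(4)[of z] that pq by auto
  then show "loxodromic f"
    unfolding loxodromic_def ifp using f(1) pq(1) by auto
qed

lemma loxodromic_fixed_points:
  assumes "loxodromic f"
  obtains p q where "p \<noteq> q" "cmod p = 1" "cmod q = 1" "bdry f p = p" "bdry f q = q"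
    "ideal_fixed_points f = {p, q}"
proof -
  have f: "f \<in> carrier Isom_plus" using assms by (simp add: loxodromic_def)
  obtain p q where pq: "ideal_fixed_points f = {p, q}" "p \<noteq> q"
    using assms unfolding loxodromic_def card_2_iff by blast
  then have "p \<in> ideal_fixed_points f" "q \<in> ideal_fixed_points f" by auto
  then show ?thesis
    using that[OF pq(2) _ _ _ _ pq(1)] by (auto simp: ideal_fixed_points_bdry[OF f])
qed

lemma loxodromic_not_one: "loxodromic f \<Longrightarrow> f \<noteq> \<one>\<^bsub>Isom_plus\<^esub>"
  unfolding loxodromic_def using Isom_plus_one[of 0] by force

text \<open>The multipliers of \<open>f\<close> and \<open>g\<close> at a common fixed point \<open>p\<close> cancel in their commutator, so the
  commutator is parabolic or trivial.  Without parabolic elements, \<open>f\<close> and \<open>g\<close> commute, and \<open>g\<close>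
  permutes the fixed points of \<open>f\<close>.\<close>

lemma common_fixed_point_imp_common_axis:
  assumes \<Gamma>: "subgroup \<Gamma> Isom_plus" "purely_loxodromic \<Gamma>"
    and f: "f \<in> \<Gamma>" "f \<noteq> \<one>\<^bsub>Isom_plus\<^esub>" and g: "g \<in> \<Gamma>"
    and pq: "p \<noteq> q" "cmod p = 1" "cmod q = 1" "bdry f p = p" "bdry f q = q" "bdry g p = p"
  shows "bdry g q = q"
proof -
  let ?m = "\<lambda>x y. x \<otimes>\<^bsub>Isom_plus\<^esub> y" and ?i = "\<lambda>x. inv\<^bsub>Isom_plus\<^esub> x"
  have fg: "f \<in> carrier Isom_plus" "g \<in> carrier Isom_plus"
    using f g subgroup.mem_carrier[OF \<Gamma>(1)] by auto
  let ?c = "?m (?m f g) (?m (?i f) (?i g))"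
  have c\<Gamma>: "?c \<in> \<Gamma>"
    using f(1) g by (intro subgroup.m_closed[OF \<Gamma>(1)] subgroup.m_inv_closed[OF \<Gamma>(1)])
  obtain l where l: "multiplier f p l" "l \<noteq> 0" using multiplier_exists[OF fg(1) pq(2,4)] .
  obtain m where m: "multiplier g p m" "m \<noteq> 0" using multiplier_exists[OF fg(2) pq(2,6)] .
  have "multiplier ?c p ((l * m) * (inverse l * inverse m))"
    using fg l m by (intro multiplier_mult multiplier_inv) auto
  moreover have "(l * m) * (inverse l * inverse m) = 1" using l m by (simp add: field_simps)
  ultimately have "multiplier ?c p 1" by simp
  then have "?c = \<one>\<^bsub>Isom_plus\<^esub>"
    using parabolic_if_multiplier_1[OF _ _ pq(2)] c\<Gamma> subgroup.mem_carrier[OF \<Gamma>(1) c\<Gamma>] \<Gamma>(2)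
    unfolding purely_loxodromic_def by blast
  moreover have "?m (?i f) (?i g) = ?i (?m g f)" using fg by (simp add: Isom.inv_mult_group)
  ultimately have "?m f g = ?m g f"
    using fg by (metis Isom.inv_equality Isom.inv_inv Isom.inv_closed Isom.m_closed)
  then have "bdry f (bdry g q) = bdry g q"
    using bdry.composition_rule[of q f g] bdry.composition_rule[of q g f] fg pq by simp
  moreover have "bdry g q \<in> circle_at_infinity"
    using bdry.act_closed fg(2) pq(3) by auto
  ultimately have "bdry g q \<in> {p, q}"
    using two_fixed_points_loxodromic(2)[OF fg(1) f(2) pq(1-5)] ideal_fixed_points_bdry[OF fg(1)]
    by blast
  moreover have "bdry g q \<noteq> bdry g p"
    using bdry.act_inj[OF fg(2), of q p] pq by simp
  ultimately show ?thesis using pq by simp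
qed

section \<open>Dynamics of a single isometry\<close>

lemma powi_escapes:
  fixes k M :: real
  assumes "k > 0" "k \<noteq> 1" "M \<ge> 1"
  obtains N :: int where "N > 0" "\<And>m. m \<noteq> 0 \<Longrightarrow> k powi (N * m) < 1 / M \<or> M < k powi (N * m)"
proof -
  have l: "ln k \<noteq> 0" using assms by simp
  obtain n :: nat where n: "ln M < real n * \<bar>ln k\<bar>"
    using ex_less_of_nat_mult[of "\<bar>ln k\<bar>" "ln M"] l by auto
  have "k powi (int n * m) < 1 / M \<or> M < k powi (int n * m)" if "m \<noteq> 0" for m :: int
  proof -
    let ?y = "k powi (int n * m)"
    have y: "?y > 0" using assms(1) by simp
    have "?y = k powr (real n * real_of_int m)"
      using powr_real_of_int'[of k "int n * m"] assms(1) by simp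
    then have "ln ?y = real n * real_of_int m * ln k"
      using assms(1) by (simp add: ln_powr)
    then have "\<bar>ln ?y\<bar> = \<bar>real_of_int m\<bar> * (real n * \<bar>ln k\<bar>)"
      by (simp add: abs_mult)
    also have "\<dots> \<ge> 1 * (real n * \<bar>ln k\<bar>)"
      using that by (intro mult_right_mono) auto
    finally have "ln M < \<bar>ln ?y\<bar>" using n by linarith
    then have "ln M < ln ?y \<or> ln ?y < ln (1 / M)"
      using assms(3) by (auto simp: ln_div abs_if split: if_splits)
    then show ?thesis using y assms(3) by auto
  qed
  moreover have "n > 0" using n assms(3) by (cases n) (auto simp: not_less[symmetric])
  ultimately show ?thesis using that[of "int n"] by simp
qed

lemma axis_coord_powi:
  assumes f: "f \<in> carrier Isom_plus" "f \<noteq> \<one>\<^bsub>Isom_plus\<^esub>"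
    and pq: "p \<noteq> q" "cmod p = 1" "cmod q = 1" "bdry f p = p" "bdry f q = q"
  obtains k :: real where "k > 0" "k \<noteq> 1"
    "\<And>(n::int) \<xi>. cmod \<xi> = 1 \<Longrightarrow>
       coord p q (bdry (f [^]\<^bsub>Isom_plus\<^esub> n) \<xi>) = of_real (k powi n) * coord p q \<xi>"
proof -
  obtain k :: real where k: "k > 0" "k \<noteq> 1"
    "\<And>\<xi>. cmod \<xi> = 1 \<Longrightarrow> coord p q (bdry f \<xi>) = of_real k * coord p q \<xi>"
    "\<And>z. cmod z < 1 \<Longrightarrow> coord p q (f z) = of_real k * coord p q z"
    by (rule axis_coord[OF assms]) (rule that)
  have closed: "cmod (bdry g \<xi>) = 1" if "g \<in> carrier Isom_plus" "cmod \<xi> = 1" for g \<xi>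
    using bdry.act_closed[of g \<xi>] that by simp
  have nat: "coord p q (bdry (f [^]\<^bsub>Isom_plus\<^esub> n) \<xi>) = of_real (k ^ n) * coord p q \<xi>"
    if "cmod \<xi> = 1" for n :: nat and \<xi>
    using that
  proof (induction n arbitrary: \<xi>)
    case 0
    then show ?case by (simp add: bdry.act_one)
  next
    case (Suc n)
    have "bdry (f [^]\<^bsub>Isom_plus\<^esub> Suc n) \<xi> = bdry (f [^]\<^bsub>Isom_plus\<^esub> n) (bdry f \<xi>)"
      using bdry.composition_rule[of \<xi> "f [^]\<^bsub>Isom_plus\<^esub> n" f] Suc.prems f(1) by simp
    then show ?case
      using Suc.IH[OF closed[OF f(1) Suc.prems]] k(3)[OF Suc.prems] by simp
  qed
  have "coord p q (bdry (f [^]\<^bsub>Isom_plus\<^esub> n) \<xi>) = of_real (k powi n) * coord p q \<xi>"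
    if \<xi>: "cmod \<xi> = 1" for n :: int and \<xi>
  proof (cases "n \<ge> 0")
    case True
    then obtain m where "n = int m" by (rule nonneg_int_cases)
    then show ?thesis using nat[OF \<xi>, of m] by (simp add: int_pow_int)
  next
    case False
    then have "n = - int (nat (- n))" by simp
    then obtain m where m: "n = - int m" by blast
    let ?g = "f [^]\<^bsub>Isom_plus\<^esub> m"
    have g: "?g \<in> carrier Isom_plus" using f(1) by simp
    have "coord p q \<xi> = of_real (k ^ m) * coord p q (bdry (inv\<^bsub>Isom_plus\<^esub> ?g) \<xi>)"
      using nat[OF closed[OF Isom.inv_closed[OF g] \<xi>], of m] bdry.act_inv'[OF g, of \<xi>] \<xi> by simp
    moreover have "f [^]\<^bsub>Isom_plus\<^esub> n = inv\<^bsub>Isom_plus\<^esub> ?g"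
      unfolding m by (rule Isom.int_pow_neg_int[OF f(1)])
    moreover have "k powi n * k ^ m = 1"
      using k(1) unfolding m by (simp add: power_int_minus)
    ultimately show ?thesis
      by (metis mult.assoc mult_1 of_real_1 of_real_mult)
  qed
  from that[OF k(1,2) this] show ?thesis .
qed

text \<open>Twice the signed area of the triangle with vertices \<open>p\<close>, \<open>q\<close>, \<open>z\<close>; its sign tells on which
  side of the chord from \<open>p\<close> to \<open>q\<close> the point \<open>z\<close> lies.\<close>

definition orient :: "complex \<Rightarrow> complex \<Rightarrow> complex \<Rightarrow> real" where
  "orient p q z = Im ((z - p) * cnj (z - q))"

definition side :: "complex \<Rightarrow> complex \<Rightarrow> complex set" where
  "side p q = {\<xi> \<in> circle_at_infinity. orient p q \<xi> > 0}"

lemma orient_swap: "orient q p z = - orient p q z"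
  by (simp add: orient_def algebra_simps)

text \<open>As isometries fixing \<open>p\<close> and \<open>q\<close> multiply the coordinate by a positive number, they preserve the
  sides.\<close>

lemma orient_pos_iff: "orient p q z > 0 \<longleftrightarrow> Im (coord p q z) > 0"
proof (cases "z = q")
  case False
  have "Im (coord p q z) = orient p q z / (cmod (z - q))\<^sup>2"
    unfolding coord_def orient_def by (subst complex_div_cnj) (metis Im_divide_of_real of_real_power)
  then show ?thesis using False by (simp add: zero_less_divide_iff)
qed (simp add: orient_def coord_def)

lemma continuous_orient: "continuous_on UNIV (orient p q)"
  unfolding orient_def[abs_def] by (intro continuous_intros)

text \<open>The condition puts \<open>z\<close> on the line through \<open>p\<close> and \<open>q\<close>, which meets the circle only there.\<close>

lemma orient_eq_0:
  assumes "p \<noteq> q" "cmod p = 1" "cmod q = 1" "cmod z = 1" "orient p q z = 0"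
  shows "z = p \<or> z = q"
proof -
  note u = assms(2-4)[THEN unit_mult_cnj]
  let ?w = "(z - p) * cnj (z - q)"
  have real: "cnj ?w = ?w"
    using assms(5) by (simp only: orient_def complex_is_Real_iff[symmetric] Reals_cnj_iff)
  have "?w * (z * q) = (z - p) * ((z * cnj z) * q - (q * cnj q) * z)"
    by (simp add: algebra_simps)
  also have "\<dots> = ((z * cnj z) * p - (p * cnj p) * z) * (z - q)"
    unfolding u by (simp add: algebra_simps)
  also have "\<dots> = cnj ?w * (z * p)"
    by (simp add: algebra_simps)
  finally have "?w * (z * q) = ?w * (z * p)"
    unfolding real .
  moreover have "z \<noteq> 0" using assms(4) by auto
  ultimately have "?w = 0" using assms(1) by simp
  then show ?thesis by auto
qed

text \<open>The witness is the midpoint of the arc.\<close>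

lemma side_nonempty:
  assumes "p \<noteq> q" "cmod p = 1" "cmod q = 1"
  shows "side p q \<noteq> {}"
proof -
  define \<xi> where "\<xi> = \<i> * (p - q) / of_real (cmod (p - q))"
  have n0: "cmod (p - q) \<noteq> 0" using assms(1) by simp
  have \<xi>: "cmod \<xi> = 1" using n0 by (simp add: \<xi>_def norm_mult norm_divide)
  have "\<xi> * cnj (p - q) = \<i> * ((p - q) * cnj (p - q)) / of_real (cmod (p - q))"
    by (simp add: \<xi>_def)
  also have "\<dots> = \<i> * of_real (cmod (p - q))"
    using n0 unfolding complex_norm_square[symmetric] by (simp add: power2_eq_square)
  finally have 1: "Im (\<xi> * cnj (p - q)) = cmod (p - q)" by simp
  have "orient p q \<xi> = Im (\<xi> * cnj \<xi>) + Im (\<xi> * cnj (p - q)) + Im (p * cnj q)"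
    by (simp add: orient_def algebra_simps)
  then have 2: "orient p q \<xi> = cmod (p - q) + Im (p * cnj q)"
    using 1 unit_mult_cnj[OF \<xi>] by simp
  let ?w = "p * cnj q"
  have w: "cmod ?w = 1" using assms by (simp add: norm_mult)
  have "(p - q) * cnj q = ?w - 1" using unit_mult_cnj[OF assms(3)] by (simp add: algebra_simps)
  then have "cmod (p - q) = cmod (?w - 1)"
    using assms(3) by (metis complex_mod_cnj mult.right_neutral norm_mult)
  moreover have "\<bar>Im ?w\<bar> < cmod (?w - 1)"
  proof -
    have "Re ?w \<noteq> 1"
    proof
      assume "Re ?w = 1"
      moreover have "Im ?w = 0" using w \<open>Re ?w = 1\<close> by (simp add: cmod_def)
      ultimately have "?w = 1" by (simp add: complex_eq_iff)
      then have "p - q = 0" using \<open>cmod (p - q) = cmod (?w - 1)\<close> by simp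
      then show False using assms(1) by simp
    qed
    then have "(Im ?w)\<^sup>2 < (cmod (?w - 1))\<^sup>2"
      unfolding cmod_power2 by simp
    then show ?thesis by (metis abs_le_square_iff abs_norm_cancel not_le)
  qed
  ultimately have "orient p q \<xi> > 0" using 2 by linarith
  then show ?thesis using \<xi> by (auto simp: side_def)
qed

lemma closure_side: "closure (side p q) \<subseteq> {\<xi> \<in> circle_at_infinity. orient p q \<xi> \<ge> 0}"
proof (rule closure_minimal)
  have "closed {\<xi>. orient p q \<xi> \<ge> 0}"
    using continuous_orient by (intro closed_Collect_le) auto
  then have "closed (circle_at_infinity \<inter> {\<xi>. orient p q \<xi> \<ge> 0})"
    by (intro closed_Int) auto
  then show "closed {\<xi> \<in> circle_at_infinity. orient p q \<xi> \<ge> 0}"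
    by (simp add: Int_def)
qed (auto simp: side_def)

lemma axis_powi_not_one:
  assumes f: "f \<in> carrier Isom_plus" "f \<noteq> \<one>\<^bsub>Isom_plus\<^esub>"
    and pq: "p \<noteq> q" "cmod p = 1" "cmod q = 1" "bdry f p = p" "bdry f q = q"
    and n: "n \<noteq> 0"
  shows "f [^]\<^bsub>Isom_plus\<^esub> (n::int) \<noteq> \<one>\<^bsub>Isom_plus\<^esub>"
proof
  assume one: "f [^]\<^bsub>Isom_plus\<^esub> n = \<one>\<^bsub>Isom_plus\<^esub>"
  obtain k :: real where k: "k > 0" "k \<noteq> 1"
    "\<And>(n::int) \<xi>. cmod \<xi> = 1 \<Longrightarrow>
       coord p q (bdry (f [^]\<^bsub>Isom_plus\<^esub> n) \<xi>) = of_real (k powi n) * coord p q \<xi>"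
    by (rule axis_coord_powi[OF f pq]) (rule that)
  obtain \<xi> where \<xi>: "\<xi> \<in> side p q" using side_nonempty[OF pq(1-3)] by blast
  then have "coord p q \<xi> \<noteq> 0" by (auto simp: side_def orient_pos_iff)
  then have "k powi n = 1"
    using k(3)[of \<xi> n] \<xi> one by (simp add: side_def bdry.act_one flip: of_real_power_int)
  moreover obtain N :: int where "k powi (N * n) < 1 / 1 \<or> 1 < k powi (N * n)"
    using powi_escapes[OF k(1,2), of 1] n by (metis order_refl)
  moreover have "k powi (N * n) = (k powi n) powi N"
    by (metis mult.commute power_int_mult)
  ultimately show False by simp
qed

text \<open>In the coordinate, a suitable power multiplies by a number as small as desired.  Whether the
  exponent \<open>n\<close> is positive or negative depends on which of \<open>p\<close> and \<open>q\<close> is attracting.\<close>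

lemma attracted_to_fixed_point:
  assumes f: "f \<in> carrier Isom_plus" "f \<noteq> \<one>\<^bsub>Isom_plus\<^esub>"
    and pq: "p \<noteq> q" "cmod p = 1" "cmod q = 1" "bdry f p = p" "bdry f q = q"
    and x: "cmod x = 1" "x \<noteq> q" and y: "cmod y = 1" "y \<noteq> q" and e: "e > 0"
  obtains n :: int where "dist (bdry (f [^]\<^bsub>Isom_plus\<^esub> n) x) p < e"
    "dist (bdry (f [^]\<^bsub>Isom_plus\<^esub> n) y) p < e"
proof -
  obtain k :: real where k: "k > 0" "k \<noteq> 1"
    "\<And>(n::int) \<xi>. cmod \<xi> = 1 \<Longrightarrow>
       coord p q (bdry (f [^]\<^bsub>Isom_plus\<^esub> n) \<xi>) = of_real (k powi n) * coord p q \<xi>"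
    by (rule axis_coord_powi[OF f pq]) (rule that)
  define M where "M = 1 + 2 * (cmod (coord p q x) + cmod (coord p q y)) / e"
  have M: "M \<ge> 1" using e by (simp add: M_def)
  obtain N :: int where N: "N > 0" "\<And>m. m \<noteq> 0 \<Longrightarrow> k powi (N * m) < 1 / M \<or> M < k powi (N * m)"
    by (rule powi_escapes[OF k(1,2) M]) (rule that)
  have "\<exists>n. k powi n < 1 / M"
  proof (cases "k powi N < 1 / M")
    case False
    then have "M < k powi N" using N(2)[of 1] by simp
    then have "k powi (- N) < 1 / M"
      using M k(1) by (simp add: power_int_minus_divide divide_strict_left_mono)
    then show ?thesis by blast
  qed blast
  then obtain n where n: "k powi n < 1 / M" by blast
  let ?g = "f [^]\<^bsub>Isom_plus\<^esub> n"
  have g: "?g \<in> carrier Isom_plus" using f(1) by simp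
  have "dist (bdry ?g u) p < e"
    if u: "cmod u = 1" "u \<noteq> q" "2 * cmod (coord p q u) / e \<le> M - 1" for u
  proof -
    let ?v = "bdry ?g u"
    have v: "cmod ?v = 1" using bdry.act_closed[OF g, of u] u by simp
    have "bdry ?g q = q" using bdry.fixed_int_pow[OF f(1), of q] pq by simp
    then have vq: "?v \<noteq> q" using bdry.act_inj[OF g, of u q] u pq by simp
    then have "cmod (?v - p) = cmod (coord p q ?v) * cmod (?v - q)"
      by (simp add: coord_def norm_divide)
    also have "\<dots> \<le> cmod (coord p q ?v) * 2"
      using norm_triangle_ineq4[of ?v q] v pq by (intro mult_left_mono) auto
    also have "\<dots> = k powi n * (2 * cmod (coord p q u))"
      using k(1) k(3)[OF u(1), of n] by (simp add: norm_mult norm_power_int)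
    also have "\<dots> \<le> 1 / M * (2 * cmod (coord p q u))"
      using n by (intro mult_right_mono) auto
    also have "\<dots> < e"
      using u(3) e M by (simp add: field_simps)
    finally show ?thesis by (simp add: dist_norm)
  qed
  then show ?thesis
    using that[of n] x y e by (simp add: M_def divide_right_mono)
qed

text \<open>The territory \<open>I\<close> consists of the points of the circle that are much closer to one of the
  fixed points \<open>r\<close>, \<open>s\<close> than to the other.  Outside of \<open>I\<close> the coordinate has modulus between \<open>\<epsilon>\<close> and
  \<open>1 / \<epsilon>\<close>, so multiplication by a number larger than \<open>1 / \<epsilon>\<^sup>2\<close> or smaller than \<open>\<epsilon>\<^sup>2\<close> leads into \<open>I\<close>.\<close>

lemma axis_ping:
  assumes f: "f \<in> carrier Isom_plus" "f \<noteq> \<one>\<^bsub>Isom_plus\<^esub>"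
    and rs: "r \<noteq> s" "cmod r = 1" "cmod s = 1" "bdry f r = r" "bdry f s = s"
    and U: "open U" "r \<in> U" "s \<in> U"
  obtains N :: int and I where "N > 0" "I \<subseteq> circle_at_infinity \<inter> U"
    "\<And>m \<xi>. m \<noteq> 0 \<Longrightarrow> \<xi> \<in> circle_at_infinity - I \<Longrightarrow> bdry (f [^]\<^bsub>Isom_plus\<^esub> (N * m)) \<xi> \<in> I"
proof -
  obtain k :: real where k: "k > 0" "k \<noteq> 1"
    "\<And>(n::int) \<xi>. cmod \<xi> = 1 \<Longrightarrow>
       coord r s (bdry (f [^]\<^bsub>Isom_plus\<^esub> n) \<xi>) = of_real (k powi n) * coord r s \<xi>"
    by (rule axis_coord_powi[OF f rs]) (rule that)
  obtain e1 where e1: "e1 > 0" "ball r e1 \<subseteq> U" using U by (meson open_contains_ball)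
  obtain e2 where e2: "e2 > 0" "ball s e2 \<subseteq> U" using U by (meson open_contains_ball)
  define \<epsilon> where "\<epsilon> = min (min e1 e2 / 2) 1"
  have \<epsilon>: "0 < \<epsilon>" "\<epsilon> \<le> 1" "2 * \<epsilon> \<le> e1" "2 * \<epsilon> \<le> e2"
    using e1 e2 by (auto simp: \<epsilon>_def min_def)
  define I where "I = {\<xi> \<in> circle_at_infinity.
    cmod (\<xi> - r) < \<epsilon> * cmod (\<xi> - s) \<or> cmod (\<xi> - s) < \<epsilon> * cmod (\<xi> - r)}"
  have close: "dist x \<xi> < 2 * \<epsilon>"
    if "cmod \<xi> = 1" "cmod y = 1" "cmod (\<xi> - x) < \<epsilon> * cmod (\<xi> - y)" for \<xi> x y
  proof -
    have "\<epsilon> * cmod (\<xi> - y) \<le> \<epsilon> * 2"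
      using norm_triangle_ineq4[of \<xi> y] that \<epsilon>(1) by (intro mult_left_mono) auto
    then show ?thesis using that(3) by (simp add: dist_norm norm_minus_commute)
  qed
  have "I \<subseteq> U"
  proof
    fix \<xi> assume \<xi>: "\<xi> \<in> I"
    then have "dist r \<xi> < 2 * \<epsilon> \<or> dist s \<xi> < 2 * \<epsilon>"
      using close[of \<xi> s r] close[of \<xi> r s] rs by (auto simp: I_def)
    then have "\<xi> \<in> ball r e1 \<or> \<xi> \<in> ball s e2" using \<epsilon> by auto
    then show "\<xi> \<in> U" using e1 e2 by blast
  qed
  then have IU: "I \<subseteq> circle_at_infinity \<inter> U" by (auto simp: I_def)
  have M: "1 \<le> 1 / \<epsilon>\<^sup>2" using \<epsilon> by (simp add: power_le_one)
  obtain N :: int where N: "N > 0"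
    "\<And>m. m \<noteq> 0 \<Longrightarrow> k powi (N * m) < 1 / (1 / \<epsilon>\<^sup>2) \<or> 1 / \<epsilon>\<^sup>2 < k powi (N * m)"
    by (rule powi_escapes[OF k(1,2) M]) (rule that)
  have "bdry (f [^]\<^bsub>Isom_plus\<^esub> (N * m)) \<xi> \<in> I"
    if m: "m \<noteq> 0" and \<xi>: "\<xi> \<in> circle_at_infinity - I" for m \<xi>
  proof -
    define K where "K = k powi (N * m)"
    define v where "v = bdry (f [^]\<^bsub>Isom_plus\<^esub> (N * m)) \<xi>"
    define c where "c = cmod (coord r s \<xi>)"
    have n\<xi>: "cmod \<xi> = 1"
      and out: "\<epsilon> * cmod (\<xi> - s) \<le> cmod (\<xi> - r)" "\<epsilon> * cmod (\<xi> - r) \<le> cmod (\<xi> - s)"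
      using \<xi> by (auto simp: I_def)
    have ne: "\<xi> \<noteq> r" "\<xi> \<noteq> s" using out rs(1) \<epsilon>(1) by (auto simp: mult_le_0_iff)
    have v: "cmod v = 1"
      using bdry.act_closed[of "f [^]\<^bsub>Isom_plus\<^esub> (N * m)" \<xi>] f(1) n\<xi> by (simp add: v_def)
    have K: "K > 0" using k(1) by (simp add: K_def)
    have c: "\<epsilon> \<le> c" "c \<le> 1 / \<epsilon>"
      using out ne \<epsilon>(1) by (simp_all add: c_def coord_def norm_divide field_simps)
    have cv: "cmod (coord r s v) = K * c"
      using k(1) k(3)[OF n\<xi>, of "N * m"] by (simp add: norm_mult norm_power_int K_def v_def c_def)
    then have "coord r s v \<noteq> 0" using K c(1) \<epsilon>(1) by auto
    then have vs: "v \<noteq> r" "v \<noteq> s" by (auto simp: coord_def)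
    from N(2)[OF m, folded K_def] have "v \<in> I"
    proof
      assume "K < 1 / (1 / \<epsilon>\<^sup>2)"
      then have "K < \<epsilon>\<^sup>2" by simp
      then have "K * c < \<epsilon>\<^sup>2 * c" using c(1) \<epsilon>(1) by (intro mult_strict_right_mono) auto
      also have "\<dots> \<le> \<epsilon>\<^sup>2 * (1 / \<epsilon>)" using c(2) by (intro mult_left_mono) auto
      also have "\<dots> = \<epsilon>" using \<epsilon>(1) by (simp add: power2_eq_square)
      finally have "cmod (v - r) < \<epsilon> * cmod (v - s)"
        using vs unfolding cv[symmetric] by (simp add: coord_def norm_divide field_simps)
      then show ?thesis using v by (simp add: I_def)
    next
      assume "1 / \<epsilon>\<^sup>2 < K"
      then have "1 / \<epsilon>\<^sup>2 * c < K * c" using c(1) \<epsilon>(1) by (intro mult_strict_right_mono) auto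
      moreover have "1 / \<epsilon>\<^sup>2 * \<epsilon> \<le> 1 / \<epsilon>\<^sup>2 * c" using c(1) by (intro mult_left_mono) auto
      moreover have "1 / \<epsilon>\<^sup>2 * \<epsilon> = 1 / \<epsilon>" using \<epsilon>(1) by (simp add: power2_eq_square)
      ultimately have "1 / \<epsilon> < K * c" by linarith
      then have "cmod (v - s) < \<epsilon> * cmod (v - r)"
        using vs \<epsilon>(1) unfolding cv[symmetric] by (simp add: coord_def norm_divide field_simps)
      then show ?thesis using v by (simp add: I_def)
    qed
    then show ?thesis unfolding v_def .
  qed
  from that[OF N(1) IU this] show ?thesis .
qed

section \<open>One-sided subgroups\<close>

text \<open>Conjugating \<open>\<gamma>\<close> by a suitable power of an \<open>h\<close> that has a fixed point on the given side pushes both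
  fixed points of \<open>\<gamma>\<close> to that side.  The other fixed point of \<open>h\<close> is not fixed by \<open>\<gamma>\<close>, as otherwise
  \<open>\<gamma>\<close> and \<open>h\<close> would have the same fixed points.\<close>

lemma axis_on_one_side:
  assumes \<Gamma>: "subgroup \<Gamma> Isom_plus" "purely_loxodromic \<Gamma>" "limit_set \<Gamma> = circle_at_infinity"
    and \<gamma>: "\<gamma> \<in> \<Gamma>" "\<gamma> \<noteq> \<one>\<^bsub>Isom_plus\<^esub>"
    and pq: "p \<noteq> q" "cmod p = 1" "cmod q = 1" "bdry \<gamma> p = p" "bdry \<gamma> q = q"
  obtains \<phi> r s where "\<phi> \<in> \<Gamma>" "\<phi> \<noteq> \<one>\<^bsub>Isom_plus\<^esub>" "r \<noteq> s" "r \<in> side p q" "s \<in> side p q"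
    "bdry \<phi> r = r" "bdry \<phi> s = s"
proof -
  let ?m = "\<lambda>x y. x \<otimes>\<^bsub>Isom_plus\<^esub> y" and ?i = "\<lambda>x. inv\<^bsub>Isom_plus\<^esub> x"
  note carrier = subgroup.mem_carrier[OF \<Gamma>(1)]
  have open_side: "open {z. orient p q z > 0}"
    using continuous_orient by (intro open_Collect_less) auto
  obtain \<xi> where \<xi>: "\<xi> \<in> side p q" using side_nonempty[OF pq(1-3)] by blast
  then obtain e where e: "e > 0" "ball \<xi> e \<subseteq> {z. orient p q z > 0}"
    using openE[OF open_side, of \<xi>] by (auto simp: side_def)
  have "\<xi> \<in> limit_set \<Gamma>" using \<xi> \<Gamma>(3) by (simp add: side_def)
  then obtain t h where h: "h \<in> \<Gamma>" "loxodromic h" "t \<in> ideal_fixed_points h" "dist t \<xi> < e"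
    unfolding limit_set_def closure_approachable using e(1) by blast
  obtain t' u' where fix_h: "t' \<noteq> u'" "cmod t' = 1" "cmod u' = 1" "bdry h t' = t'" "bdry h u' = u'"
    "ideal_fixed_points h = {t', u'}"
    using loxodromic_fixed_points[OF h(2)] .
  then obtain u where tu: "t \<noteq> u" "cmod t = 1" "cmod u = 1" "bdry h t = t" "bdry h u = u"
    using h(3) by (metis empty_iff insert_iff)
  note h1 = loxodromic_not_one[OF h(2)]
  have t: "orient p q t > 0" using e(2) h(4) by (auto simp: dist_commute)
  have tpq: "t \<noteq> p" "t \<noteq> q" using t by (auto simp: orient_def)
  have "bdry \<gamma> t \<noteq> t"
    using two_fixed_points_loxodromic(2)[OF carrier[OF \<gamma>(1)] \<gamma>(2) pq]
      ideal_fixed_points_bdry[OF carrier[OF \<gamma>(1)]] tpq tu(2) by auto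
  then have "bdry \<gamma> u \<noteq> u"
    using common_fixed_point_imp_common_axis[OF \<Gamma>(1,2) h(1) h1 \<gamma>(1), of u t] tu by metis
  then have upq: "p \<noteq> u" "q \<noteq> u" using pq by auto
  obtain e' where e': "e' > 0" "ball t e' \<subseteq> {z. orient p q z > 0}"
    using openE[OF open_side, of t] t by auto
  obtain n :: int where n: "dist (bdry (h [^]\<^bsub>Isom_plus\<^esub> n) p) t < e'"
    "dist (bdry (h [^]\<^bsub>Isom_plus\<^esub> n) q) t < e'"
    by (rule attracted_to_fixed_point[OF carrier[OF h(1)] h1 tu pq(2) upq(1) pq(3) upq(2) e'(1)])
  let ?g = "h [^]\<^bsub>Isom_plus\<^esub> n"
  let ?\<phi> = "?m (?m ?g \<gamma>) (?i ?g)"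
  have g\<Gamma>: "?g \<in> \<Gamma>" using Isom.subgroup_int_pow_closed[OF \<Gamma>(1) h(1)] .
  note c = carrier[OF g\<Gamma>] carrier[OF \<gamma>(1)]
  have "?\<phi> \<in> \<Gamma>"
    using g\<Gamma> \<gamma>(1) by (intro subgroup.m_closed[OF \<Gamma>(1)] subgroup.m_inv_closed[OF \<Gamma>(1)])
  moreover have "?\<phi> \<noteq> \<one>\<^bsub>Isom_plus\<^esub>"
  proof
    assume "?\<phi> = \<one>\<^bsub>Isom_plus\<^esub>"
    then have "?m ?g \<gamma> = ?g"
      using c by (metis Isom.inv_equality Isom.inv_inv Isom.inv_closed Isom.m_closed)
    then show False using c \<gamma>(2) by simp
  qed
  moreover have "bdry ?\<phi> (bdry ?g x) = bdry ?g x" if "cmod x = 1" "bdry \<gamma> x = x" for x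
    using that c bdry.act_closed[OF c(1), of x]
    by (simp add: bdry.composition_rule bdry.act_inv bdry.act_closed)
  moreover have "bdry ?g p \<noteq> bdry ?g q"
    using bdry.act_inj[OF c(1), of p q] pq by simp
  moreover have "bdry ?g p \<in> side p q" "bdry ?g q \<in> side p q"
    using n e'(2) bdry.act_closed[OF c(1)] pq by (auto simp: side_def dist_commute)
  ultimately show ?thesis using that[of ?\<phi> "bdry ?g p" "bdry ?g q"] pq by blast
qed

text \<open>Let \<open>\<phi>\<close> have both fixed points on the given side of the axis of \<open>\<gamma>\<close>, and replace \<open>\<phi>\<close> and \<open>\<gamma>\<close> by
  high powers.  The subgroup is the normal closure of \<open>\<phi>\<close> in the Schottky group generated by \<open>\<phi>\<close> and \<open>\<gamma>\<close>:
  it is generated by the conjugates \<open>\<gamma>\<^sup>n \<phi> \<gamma>\<^sup>-\<^sup>n\<close>.  Their territories \<open>\<gamma>\<^sup>n I\<close> all lie on the chosen side,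
  since \<open>\<gamma>\<close> preserves it, but they accumulate at both fixed points of \<open>\<gamma>\<close>.\<close>

lemma one_sided_subgroup:
  assumes \<Gamma>: "subgroup \<Gamma> Isom_plus" "purely_loxodromic \<Gamma>" "limit_set \<Gamma> = circle_at_infinity"
    and \<gamma>: "\<gamma> \<in> \<Gamma>" "\<gamma> \<noteq> \<one>\<^bsub>Isom_plus\<^esub>"
    and pq: "p \<noteq> q" "cmod p = 1" "cmod q = 1" "bdry \<gamma> p = p" "bdry \<gamma> q = q"
  obtains \<Phi> where "subgroup \<Phi> Isom_plus" "\<Phi> \<subseteq> \<Gamma>" "non_elementary \<Phi>"
    "\<And>g \<xi>. g \<in> \<Phi> \<Longrightarrow> g \<noteq> \<one>\<^bsub>Isom_plus\<^esub> \<Longrightarrow> \<xi> \<in> circle_at_infinity - side p q \<Longrightarrow> bdry g \<xi> \<in> side p q"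
    "p \<in> limit_set \<Phi>" "q \<in> limit_set \<Phi>"
proof -
  let ?m = "\<lambda>x y. x \<otimes>\<^bsub>Isom_plus\<^esub> y" and ?i = "\<lambda>x. inv\<^bsub>Isom_plus\<^esub> x"
    and ?pow = "\<lambda>x (n::int). x [^]\<^bsub>Isom_plus\<^esub> n"
  note carrier = subgroup.mem_carrier[OF \<Gamma>(1)]
  obtain \<phi> r s where \<phi>: "\<phi> \<in> \<Gamma>" "\<phi> \<noteq> \<one>\<^bsub>Isom_plus\<^esub>"
    and rs: "r \<noteq> s" "r \<in> side p q" "s \<in> side p q" "bdry \<phi> r = r" "bdry \<phi> s = s"
    by (rule axis_on_one_side[OF \<Gamma> \<gamma> pq]) (rule that)
  have rs1: "cmod r = 1" "cmod s = 1" using rs by (auto simp: side_def)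
  have pq_side: "p \<notin> side p q" "q \<notin> side p q" by (auto simp: side_def orient_def)
  define M where "M = 1 + cmod (r - p) / cmod (r - q) + cmod (r - q) / cmod (r - p)
    + cmod (s - p) / cmod (s - q) + cmod (s - q) / cmod (s - p)"
  have M: "M \<ge> 1" by (simp add: M_def add_nonneg_nonneg)
  \<comment> \<open>a neighbourhood of \<open>r\<close> and \<open>s\<close> on which the coordinate has modulus between \<open>1 / M\<close> and \<open>M\<close>\<close>
  define U where "U = {z. orient p q z > 0} \<inter> {z. cmod (z - p) < M * cmod (z - q)}
    \<inter> {z. cmod (z - q) < M * cmod (z - p)}"
  have "open U"
    unfolding U_def using continuous_orient
    by (intro open_Int open_Collect_less continuous_intros) auto
  moreover have "x \<in> U" if x: "x \<in> {r, s}" for x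
  proof -
    have nonneg: "0 \<le> cmod u / cmod v" for u v by simp
    have "cmod (r - p) / cmod (r - q) < M" "cmod (r - q) / cmod (r - p) < M"
      "cmod (s - p) / cmod (s - q) < M" "cmod (s - q) / cmod (s - p) < M"
      unfolding M_def
      using nonneg[of "r - p" "r - q"] nonneg[of "r - q" "r - p"]
        nonneg[of "s - p" "s - q"] nonneg[of "s - q" "s - p"] by linarith+
    then have "cmod (x - p) / cmod (x - q) < M" "cmod (x - q) / cmod (x - p) < M"
      using x by blast+
    moreover have "x \<noteq> p" "x \<noteq> q" using x rs pq_side by auto
    ultimately show ?thesis
      using x rs by (auto simp: U_def side_def pos_divide_less_eq)
  qed
  ultimately have U: "open U" "r \<in> U" "s \<in> U" by auto
  obtain N :: int and I where N: "N > 0" and I: "I \<subseteq> circle_at_infinity \<inter> U"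
    and ping: "\<And>m \<xi>. m \<noteq> 0 \<Longrightarrow> \<xi> \<in> circle_at_infinity - I \<Longrightarrow> bdry (?pow \<phi> (N * m)) \<xi> \<in> I"
    by (rule axis_ping[OF carrier[OF \<phi>(1)] \<phi>(2) rs(1) rs1 rs(4,5) U]) (rule that)
  obtain k :: real where k: "k > 0" "k \<noteq> 1" and coord: "\<And>(n::int) \<xi>. cmod \<xi> = 1 \<Longrightarrow>
       coord p q (bdry (?pow \<gamma> n) \<xi>) = of_real (k powi n) * coord p q \<xi>"
    by (rule axis_coord_powi[OF carrier[OF \<gamma>(1)] \<gamma>(2) pq]) (rule that)
  \<comment> \<open>The power \<open>\<gamma>\<^sup>K\<close> scales the coordinate so much that it moves this range of moduli off itself.\<close>
  have "M\<^sup>2 \<ge> 1" using M by simp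
  then obtain K :: int where K: "K > 0"
    and escape: "\<And>m. m \<noteq> 0 \<Longrightarrow> k powi (K * m) < 1 / M\<^sup>2 \<or> M\<^sup>2 < k powi (K * m)"
    by (rule powi_escapes[OF k]) (rule that)
  define g where "g n = ?pow \<gamma> (K * n)" for n
  define c where "c n = ?m (?m (g n) (?pow \<phi> N)) (?i (g n))" for n
  define T where "T n = bdry (g n) ` I" for n
  have g\<Gamma>: "g n \<in> \<Gamma>" for n
    unfolding g_def by (rule Isom.subgroup_int_pow_closed[OF \<Gamma>(1) \<gamma>(1)])
  have \<phi>N: "?pow \<phi> N \<in> \<Gamma>" by (rule Isom.subgroup_int_pow_closed[OF \<Gamma>(1) \<phi>(1)])
  have c\<Gamma>: "c n \<in> \<Gamma>" for n
    unfolding c_def using g\<Gamma> \<phi>N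
    by (intro subgroup.m_closed[OF \<Gamma>(1)] subgroup.m_inv_closed[OF \<Gamma>(1)])
  note gc = carrier[OF g\<Gamma>] and \<phi>Nc = carrier[OF \<phi>N]
  have g_coord: "coord p q (bdry (g n) \<xi>) = of_real (k powi (K * n)) * coord p q \<xi>"
    if "cmod \<xi> = 1" for n \<xi>
    unfolding g_def by (rule coord[OF that])
  have g_side: "bdry (g n) \<xi> \<in> side p q" if "\<xi> \<in> side p q" for n \<xi>
    using that k(1) g_coord[of \<xi> n] bdry.act_closed[OF gc, of \<xi> n]
    by (auto simp: side_def orient_pos_iff simp flip: of_real_power_int)
  have in_U: "\<xi> \<in> circle_at_infinity" "\<xi> \<in> U" if "\<xi> \<in> I" for \<xi>
    using I that by blast+
  have I_side: "\<xi> \<in> side p q" if "\<xi> \<in> I" for \<xi>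
    using in_U[OF that] by (simp add: U_def side_def)
  have T_side: "T n \<subseteq> side p q" for n
    using I_side g_side unfolding T_def by blast
  have coord_I: "1 / M < cmod (coord p q \<xi>)" "cmod (coord p q \<xi>) < M" if "\<xi> \<in> I" for \<xi>
  proof -
    have "\<xi> \<noteq> p" "\<xi> \<noteq> q" using I_side[OF that] pq_side by auto
    then show "1 / M < cmod (coord p q \<xi>)" "cmod (coord p q \<xi>) < M"
      using in_U[OF that] M by (auto simp: U_def coord_def norm_divide pos_divide_less_eq less_divide_eq
          divide_less_eq mult.commute)
  qed
  have T_disjoint: "T i \<inter> T j = {}" if "i \<noteq> j" for i j
  proof (rule ccontr)
    assume "T i \<inter> T j \<noteq> {}"
    then obtain x y where xy: "x \<in> I" "y \<in> I" "bdry (g i) x = bdry (g j) y"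
      by (auto simp: T_def)
    define X Y where "X = cmod (coord p q x)" and "Y = cmod (coord p q y)"
    have X: "1 / M < X" "X < M" and Y: "1 / M < Y" "Y < M"
      using coord_I xy by (auto simp: X_def Y_def)
    have pos: "X > 0" "Y > 0" using X(1) Y(1) M by (smt (verit) zero_less_divide_1_iff)+
    have "cmod x = 1" "cmod y = 1" using in_U xy by auto
    then have "k powi (K * i) * X = k powi (K * j) * Y"
      using arg_cong[OF xy(3), of "\<lambda>z. cmod (coord p q z)"] k(1)
      by (simp add: g_coord norm_mult norm_power_int X_def Y_def)
    moreover have "k powi (K * (i - j)) = k powi (K * i) / k powi (K * j)"
      using k(1) by (simp add: right_diff_distrib power_int_diff)
    moreover have "k powi (K * j) > 0" using k(1) by simp
    ultimately have ratio: "k powi (K * (i - j)) = Y / X"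
      using pos by (metis frac_eq_eq less_irrefl mult.commute)
    have "Y / X < M / (1 / M)" "(1 / M) / M < Y / X"
      using X Y pos M by (intro frac_less; simp)+
    then show False
      using escape[of "i - j"] that unfolding ratio by (simp add: power2_eq_square)
  qed
  have pingT: "bdry (?pow (c n) m) \<xi> \<in> T n" if m: "m \<noteq> 0" and \<xi>: "\<xi> \<in> circle_at_infinity - T n" for n m \<xi>
  proof -
    let ?\<eta> = "bdry (?i (g n)) \<xi>"
    have \<eta>: "?\<eta> \<in> circle_at_infinity" using \<xi> gc by (intro bdry.act_closed) auto
    moreover have "bdry (g n) ?\<eta> = \<xi>" using \<xi> gc by (intro bdry.act_inv') auto
    ultimately have "?\<eta> \<in> circle_at_infinity - I" using \<xi> unfolding T_def by (metis DiffD2 DiffI image_eqI)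
    then have "bdry (?pow \<phi> (N * m)) ?\<eta> \<in> I" by (rule ping[OF m])
    moreover have "?pow (c n) m = ?m (?m (g n) (?pow \<phi> (N * m))) (?i (g n))"
      unfolding c_def using gc \<phi>Nc carrier[OF \<phi>(1)]
      by (simp add: Isom.conj_int_pow Isom.int_pow_pow)
    ultimately show ?thesis
      using gc[of n] carrier[OF \<phi>(1)] \<xi> \<eta> by (simp add: bdry.composition_rule T_def)
  qed
  interpret ping_pong Isom_plus circle_at_infinity bdry c T
    by unfold_locales (use carrier[OF c\<Gamma>] T_disjoint pingT in auto)
  define \<Phi> where "\<Phi> = generate Isom_plus (range c)"
  have "subgroup \<Phi> Isom_plus"
    unfolding \<Phi>_def using carrier[OF c\<Gamma>] by (intro Isom.generate_is_subgroup) auto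
  moreover have "\<Phi> \<subseteq> \<Gamma>"
    unfolding \<Phi>_def using c\<Gamma> \<Gamma>(1) by (intro Isom.generate_subgroup_incl) auto
  moreover have pT: "p \<notin> (\<Union>n. T n)" using pq_side T_side by blast
  moreover have "non_elementary \<Phi>"
    unfolding non_elementary_def \<Phi>_def
    using generate_not_virtually_abelian[of 0 1 p] pT pq(2) by simp
  moreover have "bdry h \<xi> \<in> side p q"
    if "h \<in> \<Phi>" "h \<noteq> \<one>\<^bsub>Isom_plus\<^esub>" "\<xi> \<in> circle_at_infinity - side p q" for h \<xi>
    using generate_maps_into[of h \<xi>] that T_side unfolding \<Phi>_def by blast
  moreover have limit: "x \<in> limit_set \<Phi>"
    if x: "x \<noteq> y" "cmod x = 1" "cmod y = 1" "bdry \<gamma> x = x" "bdry \<gamma> y = y" "{x, y} = {p, q}" for x y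
    unfolding limit_set_def closure_approachable
  proof (intro allI impI)
    fix e :: real assume e: "e > 0"
    have g1: "?pow \<gamma> K \<in> carrier Isom_plus" "?pow \<gamma> K \<noteq> \<one>\<^bsub>Isom_plus\<^esub>"
      using gc[of 1] axis_powi_not_one[OF carrier[OF \<gamma>(1)] \<gamma>(2) pq, of K] K by (simp_all add: g_def)
    have fixed: "bdry (?pow \<gamma> K) x = x" "bdry (?pow \<gamma> K) y = y"
      using x bdry.fixed_int_pow[OF carrier[OF \<gamma>(1)]] by auto
    have ry: "r \<noteq> y" using rs(2) pq_side x(6) by (metis doubleton_eq_iff)
    obtain n :: int where n: "dist (bdry (?pow (?pow \<gamma> K) n) r) x < e"
      by (rule attracted_to_fixed_point[OF g1 x(1-3) fixed rs1(1) ry rs1(1) ry e])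
    have "?pow (?pow \<gamma> K) n = g n"
      using carrier[OF \<gamma>(1)] by (simp add: g_def Isom.int_pow_pow)
    then have close: "dist (bdry (g n) r) x < e" using n by simp
    have fix_c: "bdry (c n) (bdry (g n) t) = bdry (g n) t" if "cmod t = 1" "bdry \<phi> t = t" for t
      using that gc[of n] \<phi>Nc bdry.fixed_int_pow[OF carrier[OF \<phi>(1)], of t N]
        bdry.act_closed[OF gc[of n], of t]
      by (simp add: c_def bdry.composition_rule bdry.act_inv bdry.act_closed)
    have "bdry (c n) p \<in> T n"
      using pingT[of 1 p n] pT pq(2) carrier[OF c\<Gamma>] by simp
    then have "bdry (c n) p \<noteq> p" using pT by auto
    then have c1: "c n \<noteq> \<one>\<^bsub>Isom_plus\<^esub>" using pq(2) bdry.act_one by auto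
    have "bdry (g n) r \<noteq> bdry (g n) s" "cmod (bdry (g n) r) = 1" "cmod (bdry (g n) s) = 1"
      using bdry.act_inj[OF gc, of r s n] bdry.act_closed[OF gc, of _ n] rs(1) rs1 by auto
    from two_fixed_points_loxodromic[OF carrier[OF c\<Gamma>] c1 this fix_c[OF rs1(1) rs(4)] fix_c[OF rs1(2) rs(5)]]
    have "loxodromic (c n)" "bdry (g n) r \<in> ideal_fixed_points (c n)" by auto
    moreover have "c n \<in> \<Phi>" unfolding \<Phi>_def by (simp add: generate.incl)
    ultimately show "\<exists>z\<in>(\<Union>h\<in>{h \<in> \<Phi>. loxodromic h}. ideal_fixed_points h). dist z x < e"
      using close by blast
  qed
  have "p \<in> limit_set \<Phi>" "q \<in> limit_set \<Phi>"
    using limit[of p q] limit[of q p] pq by auto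
  ultimately show ?thesis using that by blast
qed

text \<open>A fixed point off the chosen side would be moved to that side.\<close>

lemma limit_set_on_one_side:
  assumes \<Phi>: "\<Phi> \<subseteq> carrier Isom_plus"
    and maps: "\<And>g \<xi>. g \<in> \<Phi> \<Longrightarrow> g \<noteq> \<one>\<^bsub>Isom_plus\<^esub> \<Longrightarrow> \<xi> \<in> circle_at_infinity - side p q \<Longrightarrow> bdry g \<xi> \<in> side p q"
  shows "limit_set \<Phi> \<subseteq> {\<xi> \<in> circle_at_infinity. orient p q \<xi> \<ge> 0}"
proof -
  have "ideal_fixed_points g \<subseteq> side p q" if g: "g \<in> \<Phi>" "loxodromic g" for g
    using maps[OF g(1) loxodromic_not_one[OF g(2)]] ideal_fixed_points_bdry[of g] g(1) \<Phi> by force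
  then have "limit_set \<Phi> \<subseteq> closure (side p q)"
    unfolding limit_set_def by (intro closure_mono) blast
  then show ?thesis using closure_side by blast
qed

theorem proposition2:
  fixes \<Gamma> :: "(complex \<Rightarrow> complex) set"
  assumes "fuchsian \<Gamma>"
    and "finitely_generated \<Gamma>"
    and "purely_loxodromic \<Gamma>"
    and "limit_set \<Gamma> = circle_at_infinity"
  shows "\<exists>\<Phi> \<Theta>.
      subgroup \<Phi> (Isom_plus\<lparr>carrier := \<Gamma>\<rparr>) \<and> subgroup \<Theta> (Isom_plus\<lparr>carrier := \<Gamma>\<rparr>) \<and>
      non_elementary \<Phi> \<and> non_elementary \<Theta> \<and>
      \<Phi> \<inter> \<Theta> = {\<one>\<^bsub>Isom_plus\<^esub>} \<and>
      card (limit_set \<Phi> \<inter> limit_set \<Theta>) = 2 \<and>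
      limit_set (\<Phi> \<inter> \<Theta>) \<noteq> limit_set \<Phi> \<inter> limit_set \<Theta>"
proof -
  have \<Gamma>: "subgroup \<Gamma> Isom_plus" using assms(1) by (simp add: fuchsian_def)
  have "limit_set \<Gamma> \<noteq> {}" using assms(4) by simp
  then obtain \<gamma> where \<gamma>: "\<gamma> \<in> \<Gamma>" "loxodromic \<gamma>" unfolding limit_set_def by auto
  note \<gamma>1 = loxodromic_not_one[OF \<gamma>(2)]
  obtain p q where pq: "p \<noteq> q" "cmod p = 1" "cmod q = 1" "bdry \<gamma> p = p" "bdry \<gamma> q = q"
    using loxodromic_fixed_points[OF \<gamma>(2)] .
  obtain \<Phi> where \<Phi>: "subgroup \<Phi> Isom_plus" "\<Phi> \<subseteq> \<Gamma>" "non_elementary \<Phi>"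
    and \<Phi>_maps: "\<And>g \<xi>. g \<in> \<Phi> \<Longrightarrow> g \<noteq> \<one>\<^bsub>Isom_plus\<^esub> \<Longrightarrow> \<xi> \<in> circle_at_infinity - side p q
      \<Longrightarrow> bdry g \<xi> \<in> side p q"
    and \<Phi>_pq: "p \<in> limit_set \<Phi>" "q \<in> limit_set \<Phi>"
    by (rule one_sided_subgroup[OF \<Gamma> assms(3,4) \<gamma>(1) \<gamma>1 pq]) (rule that)
  obtain \<Theta> where \<Theta>: "subgroup \<Theta> Isom_plus" "\<Theta> \<subseteq> \<Gamma>" "non_elementary \<Theta>"
    and \<Theta>_maps: "\<And>g \<xi>. g \<in> \<Theta> \<Longrightarrow> g \<noteq> \<one>\<^bsub>Isom_plus\<^esub> \<Longrightarrow> \<xi> \<in> circle_at_infinity - side q p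
      \<Longrightarrow> bdry g \<xi> \<in> side q p"
    and \<Theta>_pq: "q \<in> limit_set \<Theta>" "p \<in> limit_set \<Theta>"
    by (rule one_sided_subgroup[OF \<Gamma> assms(3,4) \<gamma>(1) \<gamma>1 pq(1)[symmetric] pq(3,2,5,4)]) (rule that)
  have side_pq: "p \<notin> side p q" "p \<notin> side q p" "side p q \<inter> side q p = {}"
    by (auto simp: side_def orient_swap[of q p]) (auto simp: orient_def)
  have "g = \<one>\<^bsub>Isom_plus\<^esub>" if "g \<in> \<Phi> \<inter> \<Theta>" for g
    using \<Phi>_maps[of g p] \<Theta>_maps[of g p] that side_pq pq(2) by auto
  then have trivial: "\<Phi> \<inter> \<Theta> = {\<one>\<^bsub>Isom_plus\<^esub>}"
    using subgroup.one_closed[OF \<Phi>(1)] subgroup.one_closed[OF \<Theta>(1)] by blast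
  have "limit_set \<Phi> \<inter> limit_set \<Theta> \<subseteq> {p, q}"
    using limit_set_on_one_side[OF subgroup.subset[OF \<Phi>(1)] \<Phi>_maps]
      limit_set_on_one_side[OF subgroup.subset[OF \<Theta>(1)] \<Theta>_maps] orient_eq_0[OF pq(1-3)]
    by (force simp: orient_swap[of q p])
  then have limits: "limit_set \<Phi> \<inter> limit_set \<Theta> = {p, q}"
    using \<Phi>_pq \<Theta>_pq by auto
  have "limit_set {\<one>\<^bsub>Isom_plus\<^esub>} = {}"
    unfolding limit_set_def using loxodromic_not_one by auto
  then show ?thesis
    using \<Phi> \<Theta> \<Gamma> trivial limits pq(1)
    by (intro exI[of _ \<Phi>] exI[of _ \<Theta>]) (simp add: Isom.subgroup_incl)
qed

end
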